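(* Let $d,m,n$ be positive integers, let $\alpha\in(0,1)$, and let $c_\alpha>0$ be a constant with $c_\alpha\le (1-\alpha)^2/384$. Suppose that $\rho>0$ satisfies $$\rho^2 < c_\alpha\,\frac{\sqrt{d\,(m\wedge d)}}{n}.$$ Then $$\inf_{T\in\mathcal{T}_{dist}} \mathcal{R}(H_\rho,T) > \alpha ,$$ where the infimum is over all distributed (1-bit, public coin) tests and $\mathcal{R}$ is the testing risk.
   Context: Notation: $a\wedge b=\min\{a,b\}$; $\|\cdot\|$ is the Euclidean norm. Model: there are $m$ machines. For $\mu\in\mathbb{R}^d$, machine $j\in\{1,\dots,m\}$ observes $X^{(j)}=\mu+\sqrt{m/n}\,Z^{(j)}$, where $Z^{(1)},\dots,Z^{(m)}$ are independent $N_d(0,I_d)$ vectors. One tests $H_0:\mu=0$ against $H_\rho:\|\mu\|\ge\rho$ (also write $H_\rho=\{\mu\in\mathbb{R}^d:\|\mu\|\ge\rho\}$). Distributed tests: a distributed test consists of a public coin, i.e. a random vector $U$ (with arbitrary distribution, chosen as part of the test and not depending on $\mu$) which is independent of $(X^{(1)},\dots,X^{(m)})$ and available to all machines; local outcomes $T^{(j)}\in\{0,1\}$, $j=1,\dots,m$, where $T^{(j)}$ is generated by machine $j$ from $(X^{(j)},U)$ only (possibly with local randomization, i.e. $T^{(j)}$ is drawn from a Markov kernel given $(X^{(j)},U)$, independently across machines conditionally on $(X^{(1)},\dots,X^{(m)},U)$); and a final decision $T\in\{0,1\}$ that is a function of $(T^{(1)},\dots,T^{(m)})$. The collection of all such tests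 $T$ is $\mathcal{T}_{dist}$. Risk: with $P_\mu$ the underlying probability distribution (of data, public coin and local randomization) when $\mu$ is the true signal, $$\mathcal{R}(H_\rho,T)=P_0(T=1)+\sup_{\|\mu\|\ge\rho}P_\mu(T=0).$$ *)

theory Defs
  imports "HOL-Probability.Probability"
begin

definition std_gaussian :: "(real ^ 'd) measure" where
  "std_gaussian =
     distr (\<Pi>\<^sub>M i\<in>(UNIV :: 'd set). density lborel std_normal_density) borel (\<lambda>z. \<chi> i. z i)"

text \<open>Joint law of the observations, machine \<open>j < m\<close> observing
  \<open>X\<^sub>j = \<mu> + sqrt (m / n) Z\<^sub>j\<close>. Machines are indexed from \<open>0\<close>.\<close>

definition data_law :: "nat \<Rightarrow> nat \<Rightarrow> real ^ 'd \<Rightarrow> (nat \<Rightarrow> real ^ 'd) measure" where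
  "data_law m n \<mu> =
     distr (\<Pi>\<^sub>M j\<in>{..<m}. std_gaussian) (\<Pi>\<^sub>M j\<in>{..<m}. borel)
       (\<lambda>z. \<lambda>j\<in>{..<m}. \<mu> + sqrt (real m / real n) *\<^sub>R z j)"

text \<open>A test is given by the law of its public coin, one kernel per machine (from observation and
  coin to a bit, \<open>True\<close> being \<open>1\<close>), and a deterministic decision based on the bits. The coin is
  a random vector of arbitrary finite dimension \<open>k\<close>, stored as a function on \<open>{..<k}\<close>. Only the
  kernels with index below \<open>m\<close> are used.\<close>

record 'd dist_test =
  coin :: "(nat \<Rightarrow> real) measure"
  kernel :: "nat \<Rightarrow> (real ^ 'd) \<times> (nat \<Rightarrow> real) \<Rightarrow> bool measure"
  decision :: "(nat \<Rightarrow> bool) \<Rightarrow> bool"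

definition dist_tests :: "nat \<Rightarrow> ('d::finite) dist_test set" where
  "dist_tests m = {T.
     prob_space (coin T) \<and>
     (\<exists>k. sets (coin T) = sets (\<Pi>\<^sub>M i\<in>{..<k}. (borel :: real measure))) \<and>
     (\<forall>j<m. kernel T j \<in> borel \<Otimes>\<^sub>M coin T \<rightarrow>\<^sub>M prob_algebra (count_space UNIV))}"

text \<open>Law of the vector of bits under \<open>\<mu>\<close>: the coin is independent of the data, and given data and
  coin the bits are independent across machines.\<close>

definition bits_law :: "nat \<Rightarrow> nat \<Rightarrow> real ^ 'd \<Rightarrow> 'd dist_test \<Rightarrow> (nat \<Rightarrow> bool) measure" where
  "bits_law m n \<mu> T =
     (data_law m n \<mu> \<Otimes>\<^sub>M coin T) \<bind> (\<lambda>(x, u). \<Pi>\<^sub>M j\<in>{..<m}. kernel T j (x j, u))"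

definition risk :: "nat \<Rightarrow> nat \<Rightarrow> real \<Rightarrow> ('d::finite) dist_test \<Rightarrow> real" where
  "risk m n \<rho> T =
     \<P>(t in bits_law m n 0 T. decision T t) +
     (SUP \<mu>\<in>{\<mu>. norm \<mu> \<ge> \<rho>}. \<P>(t in bits_law m n \<mu> T. \<not> decision T t))"

end

theory Submission
  imports Defs
begin

text \<open>
  Put the uniform prior on the \<open>2 ^ d\<close> vectors \<open>\<mu>\<close> of norm \<open>\<rho>\<close> with coordinates \<open>\<rho> / sqrt d\<close> up to sign,
  and let \<open>s\<close> be the resulting shift of each coordinate in units of the noise, so that
  \<open>s\<^sup>2 = n \<rho>\<^sup>2 / (m d)\<close>. Since the prior does not depend on the coin, the coin may be fixed. The relative
  entropy of the mixture law of the bits with respect to their law under \<open>\<mu> = 0\<close> is expanded by the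
  chain rule over the machines. The term of machine \<open>j\<close> is at most \<open>8 s\<^sup>2\<close> times the information
  that the previous \<open>j\<close> bits carry about the signs, plus \<open>d s\<^sup>4\<close>: this is a
  data processing inequality for the Gaussian channel, proved for one coordinate and tensorised in
  its dual (exponential) form. The previous bits carry at most \<open>j \<eta>\<close> with \<open>\<eta>\<close> of
  order \<open>s\<^sup>2 + d s\<^sup>4\<close>, because the likelihood ratios have Gram matrix
  \<open>exp (s\<^sup>2 \<langle>A, B\<rangle>)\<close>, whose eigenvalues on the cube are explicit. Hence the relative entropy is
  of order \<open>m\<^sup>2 s\<^sup>4 + m d s\<^sup>4\<close>, which is \<open>O(c\<^sup>2)\<close> by the assumption on \<open>\<rho>\<close>. The variational
  formula for relative entropy turns this into a bound on the error probabilities; it is used throughout in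
  place of relative entropies of continuous laws.
\<close>

section \<open>Information inequalities for finitely many bits\<close>

text \<open>Fenchel-Young inequality for the pair \<open>exp\<close> and
  \<open>v * ln v - v\<close>: the tangent bound \<open>1 + x \<le> exp x\<close> at
  \<open>x = u - ln v\<close>, multiplied by \<open>v\<close>.\<close>

lemma young_entropy:
  fixes u v :: real
  assumes "0 \<le> v"
  shows "u * v \<le> v * ln v - v + exp u"
proof (cases "v = 0")
  case False
  then have v: "v > 0" using assms by simp
  have "1 + (u - ln v) \<le> exp (u - ln v)" by (rule exp_ge_add_one_self)
  then have "v * (1 + (u - ln v)) \<le> v * exp (u - ln v)" using v by simp
  also have "v * exp (u - ln v) = exp u" using v by (simp add: exp_diff)
  finally show ?thesis by (simp add: algebra_simps)
qed simp

text \<open>The bound \<open>ln v \<le> v - 1\<close> trades entropy for a square, so that only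
  second moments of likelihood ratios have to be computed.\<close>

lemma young_square:
  fixes u v :: real
  assumes "0 \<le> v"
  shows "u * v \<le> v\<^sup>2 - 2 * v + exp u"
proof -
  have "v * ln v \<le> v * (v - 1)"
    using assms ln_le_minus_one[of v] by (cases "v = 0") (auto intro!: mult_left_mono)
  then show ?thesis using young_entropy[OF assms, of u] by (simp add: power2_eq_square algebra_simps)
qed

text \<open>Donsker-Varadhan inequality: Young's inequality for \<open>F - ln S\<close>, where
  \<open>S\<close> is the normalising constant that gives the exponential term mean 1. Here
  \<open>h\<close> is a density with respect to the weights \<open>w\<close>.\<close>

lemma gibbs_variational:
  fixes w h F :: "'r \<Rightarrow> real"
  assumes "finite R" and w: "\<And>r. r \<in> R \<Longrightarrow> 0 < w r" and w1: "(\<Sum>r\<in>R. w r) = 1"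
    and h: "\<And>r. r \<in> R \<Longrightarrow> 0 \<le> h r" and h1: "(\<Sum>r\<in>R. w r * h r) = 1"
  shows "(\<Sum>r\<in>R. w r * (h r * F r)) \<le> (\<Sum>r\<in>R. w r * (h r * ln (h r))) + ln (\<Sum>r\<in>R. w r * exp (F r))"
proof -
  define S where "S = (\<Sum>r\<in>R. w r * exp (F r))"
  have "R \<noteq> {}" using w1 by auto
  then have S: "S > 0" unfolding S_def using assms by (intro sum_pos) auto
  have "(\<Sum>r\<in>R. w r * ((F r - ln S) * h r)) \<le> (\<Sum>r\<in>R. w r * (h r * ln (h r) - h r + exp (F r - ln S)))"
    using w h young_entropy by (intro sum_mono mult_left_mono) (auto simp: less_imp_le)
  also have "\<dots> = (\<Sum>r\<in>R. w r * (h r * ln (h r))) - (\<Sum>r\<in>R. w r * h r) + (\<Sum>r\<in>R. w r * exp (F r)) / S"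
    using S by (simp add: exp_diff algebra_simps sum.distrib sum_subtractf sum_divide_distrib)
  also have "\<dots> = (\<Sum>r\<in>R. w r * (h r * ln (h r)))" using S h1 by (simp add: S_def)
  finally have "(\<Sum>r\<in>R. w r * ((F r - ln S) * h r)) \<le> (\<Sum>r\<in>R. w r * (h r * ln (h r)))" .
  moreover have "(\<Sum>r\<in>R. w r * ((F r - ln S) * h r)) = (\<Sum>r\<in>R. w r * (h r * F r)) - ln S * (\<Sum>r\<in>R. w r * h r)"
    by (simp add: algebra_simps sum_subtractf sum_distrib_left)
  ultimately show ?thesis using h1 by (simp add: S_def)
qed

lemma sum_bool: "(\<Sum>b\<in>UNIV. f b) = f True + f False"
  by (simp add: UNIV_bool add.commute)

text \<open>Relative entropy is dominated by chi-square divergence (from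
  \<open>ln x \<le> x - 1\<close>), which for two-point laws has the closed form on the
  right.\<close>

lemma relative_entropy_bit_le:
  fixes q q0 :: "bool \<Rightarrow> real"
  assumes "\<And>b. 0 \<le> q b" "\<And>b. 0 \<le> q0 b" "q True + q False = 1" "q0 True + q0 False = 1"
    and ac: "\<And>b. q0 b = 0 \<Longrightarrow> q b = 0"
  shows "(\<Sum>b\<in>UNIV. q b * ln (q b / q0 b)) \<le> (q True - q0 True)\<^sup>2 / (q0 True * q0 False)"
proof (cases "q0 True = 0 \<or> q0 False = 0")
  \<comment> \<open>The right-hand side is 0 by the convention for division by zero;
    \<open>ac\<close> forces \<open>q = q0\<close>, so the left-hand side vanishes too.\<close>
  case True
  then show ?thesis using assms by (auto simp: sum_bool)
next
  case False
  then have p: "q0 True > 0" "q0 False > 0" using assms(2)[of True] assms(2)[of False] by linarith+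
  have *: "q b * ln (q b / q0 b) \<le> (q b)\<^sup>2 / q0 b - q b" for b
  proof (cases "q b = 0")
    case F: False
    have "q0 b > 0" using p by (cases b) auto
    moreover have "q b > 0" using F assms(1)[of b] by linarith
    ultimately have "ln (q b / q0 b) \<le> q b / q0 b - 1" by (intro ln_le_minus_one) auto
    then have "q b * ln (q b / q0 b) \<le> q b * (q b / q0 b - 1)" using \<open>q b > 0\<close> by simp
    then show ?thesis by (simp add: power2_eq_square algebra_simps)
  qed simp
  have "(\<Sum>b\<in>UNIV. q b * ln (q b / q0 b)) \<le> (\<Sum>b\<in>UNIV. (q b)\<^sup>2 / q0 b - q b)"
    by (intro sum_mono *)
  also have "\<dots> = (q True)\<^sup>2 / q0 True + (q False)\<^sup>2 / q0 False - 1"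
    using assms by (simp add: sum_bool)
  also have "\<dots> = (q True - q0 True)\<^sup>2 / (q0 True * q0 False)"
  proof -
    have e: "q0 False = 1 - q0 True" "q False = 1 - q True" using assms by auto
    show ?thesis using p unfolding e by (simp add: field_simps) algebra
  qed
  finally show ?thesis .
qed

section \<open>Bit vectors and laws of independent bits\<close>

abbreviation bit_vectors :: "nat \<Rightarrow> (nat \<Rightarrow> bool) set" where
  "bit_vectors m \<equiv> PiE {..<m} (\<lambda>_. UNIV)"

lemma finite_bit_vectors [simp]: "finite (bit_vectors m)"
  by (simp add: finite_PiE)

lemma sum_bit_vectors_Suc:
  "(\<Sum>t\<in>bit_vectors (Suc m). F t) = (\<Sum>t\<in>bit_vectors m. \<Sum>b\<in>UNIV. F (t(m := b)))"
proof -
  have "(\<Sum>t\<in>bit_vectors (Suc m). F t)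
      = (\<Sum>t\<in>(\<lambda>(y, g). g(m := y)) ` (UNIV \<times> bit_vectors m). F t)"
    by (simp add: lessThan_Suc PiE_insert_eq)
  also have "\<dots> = (\<Sum>x\<in>UNIV \<times> bit_vectors m. F ((\<lambda>(y, g). g(m := y)) x))"
    by (subst sum.reindex) (use inj_combinator[of m "{..<m}" "\<lambda>_. UNIV :: bool set"] in \<open>auto simp: o_def\<close>)
  also have "\<dots> = (\<Sum>b\<in>UNIV. \<Sum>t\<in>bit_vectors m. F (t(m := b)))"
    by (simp add: sum.cartesian_product split_def)
  also have "\<dots> = (\<Sum>t\<in>bit_vectors m. \<Sum>b\<in>UNIV. F (t(m := b)))"
    by (rule sum.swap)
  finally show ?thesis .
qed

definition bits_prob :: "(nat \<Rightarrow> bool \<Rightarrow> real) \<Rightarrow> nat \<Rightarrow> (nat \<Rightarrow> bool) \<Rightarrow> real" where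
  "bits_prob q m t = (\<Prod>j<m. q j (t j))"

lemma bits_prob_Suc: "bits_prob q (Suc m) (t(m := b)) = bits_prob q m t * q m b"
proof -
  have "(\<Prod>j<m. q j ((t(m := b)) j)) = (\<Prod>j<m. q j (t j))" by (rule prod.cong) auto
  then show ?thesis by (simp add: bits_prob_def)
qed

lemma bits_prob_nonneg: "(\<And>j b. j < m \<Longrightarrow> 0 \<le> q j b) \<Longrightarrow> 0 \<le> bits_prob q m t"
  unfolding bits_prob_def by (intro prod_nonneg) auto

lemma sum_bits_prob: "(\<And>j. j < m \<Longrightarrow> (\<Sum>b\<in>UNIV. q j b) = 1) \<Longrightarrow> (\<Sum>t\<in>bit_vectors m. bits_prob q m t) = 1"
proof (induction m)
  case 0
  then show ?case by (simp add: bits_prob_def)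
next
  case (Suc m)
  then show ?case
    by (simp add: sum_bit_vectors_Suc bits_prob_Suc flip: sum_distrib_left)
qed

text \<open>Isolates what the entropy argument needs from the Gaussian model. The parameter
  \<open>r\<close> has prior \<open>w\<close>, and \<open>q0\<close> is the law of the bits under
  the null hypothesis. \<open>variance\<close> bounds the chi-square divergence of one bit averaged
  over the prior; it is multiplied out so that it retains content when \<open>q0\<close> is
  degenerate. \<open>transport\<close> is data processing in dual form: by the variational formula
  it says that if the prior is reweighted by \<open>h\<close>, then the relative entropy of bit
  \<open>j\<close> from \<open>q0 j\<close> is at most \<open>\<kappa>\<close> times the entropy of
  \<open>h\<close>, plus \<open>\<delta>\<close>.\<close>

locale bit_machines =
  fixes R :: "'r set" and w :: "'r \<Rightarrow> real" and q :: "'r \<Rightarrow> nat \<Rightarrow> bool \<Rightarrow> real"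
    and q0 :: "nat \<Rightarrow> bool \<Rightarrow> real" and m :: nat and \<eta> \<kappa> \<delta> :: real
  assumes finite_R: "finite R" and w_pos: "\<And>r. r \<in> R \<Longrightarrow> 0 < w r" and sum_w: "(\<Sum>r\<in>R. w r) = 1"
    and q_nonneg: "\<And>r j b. r \<in> R \<Longrightarrow> j < m \<Longrightarrow> 0 \<le> q r j b"
    and q_sum: "\<And>r j. r \<in> R \<Longrightarrow> j < m \<Longrightarrow> q r j True + q r j False = 1"
    and q0_nonneg: "\<And>j b. j < m \<Longrightarrow> 0 \<le> q0 j b"
    and q0_sum: "\<And>j. j < m \<Longrightarrow> q0 j True + q0 j False = 1"
    and variance: "\<And>j. j < m \<Longrightarrow>
      (\<Sum>r\<in>R. w r * (q r j True - q0 j True)\<^sup>2) \<le> \<eta> * (q0 j True * q0 j False)"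
    and transport: "\<And>j h u. j < m \<Longrightarrow> (\<And>r. r \<in> R \<Longrightarrow> 0 \<le> h r) \<Longrightarrow> (\<Sum>r\<in>R. w r * h r) = 1 \<Longrightarrow>
      (\<Sum>b\<in>UNIV. (\<Sum>r\<in>R. w r * (h r * q r j b)) * u b)
        \<le> ln (\<Sum>b\<in>UNIV. q0 j b * exp (u b)) + \<kappa> * (\<Sum>r\<in>R. w r * (h r * ln (h r))) + \<delta>"
    and eta_nonneg: "0 \<le> \<eta>" and kappa_nonneg: "0 \<le> \<kappa>"
begin

text \<open>If \<open>q0 j\<close> is degenerate then \<open>variance\<close> has right-hand side 0,
  and since all weights are positive every \<open>q r j\<close> must agree with
  \<open>q0 j\<close>.\<close>

lemma abs_cont:
  assumes "r \<in> R" "j < m" "q0 j b = 0"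
  shows "q r j b = 0"
proof -
  have "(\<Sum>r\<in>R. w r * (q r j True - q0 j True)\<^sup>2) \<le> 0"
    using variance[OF assms(2)] assms(3) by (cases b) auto
  moreover have nn: "\<And>r. r \<in> R \<Longrightarrow> 0 \<le> w r * (q r j True - q0 j True)\<^sup>2"
    using w_pos by (simp add: less_imp_le)
  ultimately have "(\<Sum>r\<in>R. w r * (q r j True - q0 j True)\<^sup>2) = 0"
    using sum_nonneg[of R "\<lambda>r. w r * (q r j True - q0 j True)\<^sup>2"] by fastforce
  then have "w r * (q r j True - q0 j True)\<^sup>2 = 0"
    using nn finite_R assms(1) by (subst (asm) sum_nonneg_eq_0_iff) auto
  then have "q r j True = q0 j True" using w_pos[OF assms(1)] by simp
  then show ?thesis
    using q_sum[OF assms(1,2)] q0_sum[OF assms(2)] assms(3) by (cases b) auto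
qed

lemma abs_cont_bits:
  assumes "r \<in> R" "k \<le> m" "bits_prob q0 k t = 0"
  shows "bits_prob (q r) k t = 0"
proof -
  obtain j where "j < k" "q0 j (t j) = 0" using assms(3) by (auto simp: bits_prob_def prod_zero_iff)
  then have "q r j (t j) = 0" using abs_cont[OF assms(1)] assms(2) by auto
  then show ?thesis using \<open>j < k\<close> by (auto simp: bits_prob_def)
qed

lemma relative_entropy_le:
  assumes "j < m"
  shows "(\<Sum>r\<in>R. w r * (\<Sum>b\<in>UNIV. q r j b * ln (q r j b / q0 j b))) \<le> \<eta>"
proof -
  have "(\<Sum>r\<in>R. w r * (\<Sum>b\<in>UNIV. q r j b * ln (q r j b / q0 j b)))
      \<le> (\<Sum>r\<in>R. w r * ((q r j True - q0 j True)\<^sup>2 / (q0 j True * q0 j False)))"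
    using assms w_pos q_nonneg q0_nonneg q_sum q0_sum abs_cont
    by (intro sum_mono mult_left_mono relative_entropy_bit_le) (auto simp: less_imp_le)
  also have "\<dots> = (\<Sum>r\<in>R. w r * (q r j True - q0 j True)\<^sup>2) / (q0 j True * q0 j False)"
    by (simp add: sum_divide_distrib)
  also have "\<dots> \<le> \<eta>"
  proof (cases "q0 j True * q0 j False = 0")
    case False
    then have "q0 j True * q0 j False > 0"
      using q0_nonneg[OF assms, of True] q0_nonneg[OF assms, of False] by (simp add: less_le)
    then show ?thesis using variance[OF assms] by (subst pos_divide_le_eq) auto
  qed (use eta_nonneg in auto)
  finally show ?thesis .
qed

text \<open>Relative entropy is additive for product laws, so each machine contributes at most
  \<open>\<eta>\<close> on average over the prior.\<close>

lemma relative_entropy_bits_le: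
  assumes "k \<le> m"
  shows "(\<Sum>t\<in>bit_vectors k. \<Sum>r\<in>R. w r * (bits_prob (q r) k t * ln (bits_prob (q r) k t / bits_prob q0 k t)))
    \<le> k * \<eta>"
  using assms
proof (induction k)
  case 0
  then show ?case by (simp add: bits_prob_def)
next
  case (Suc k)
  let ?P = "\<lambda>r t. bits_prob (q r) k t" and ?Q = "\<lambda>t. bits_prob q0 k t"
  have k: "k < m" "k \<le> m" using Suc.prems by auto
  \<comment> \<open>Chain rule for one summand. Terms of probability 0 vanish on both sides;
    otherwise absolute continuity makes all four factors positive and the logarithm splits.\<close>
  have split: "?P r t * q r k b * ln (?P r t * q r k b / (?Q t * q0 k b))
      = ?P r t * ln (?P r t / ?Q t) * q r k b + ?P r t * (q r k b * ln (q r k b / q0 k b))"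
    if "r \<in> R" for r t b
  proof (cases "?P r t = 0 \<or> q r k b = 0")
    case False
    then have "?P r t > 0" "q r k b > 0" "?Q t > 0" "q0 k b > 0"
      using abs_cont[OF that k(1), of b] abs_cont_bits[OF that k(2), of t] q_nonneg[OF that] q0_nonneg k
        bits_prob_nonneg[of k "q r" t] bits_prob_nonneg[of k q0 t]
      by (force simp: less_le)+
    then have "ln (?P r t * q r k b / (?Q t * q0 k b)) = ln (?P r t / ?Q t) + ln (q r k b / q0 k b)"
      by (simp add: ln_mult ln_div)
    then show ?thesis by (simp add: algebra_simps)
  qed auto
  have qs: "(\<Sum>b\<in>UNIV. q r k b) = 1" if "r \<in> R" for r
    using q_sum[OF that k(1)] by (simp add: sum_bool)
  have Ps: "(\<Sum>t\<in>bit_vectors k. ?P r t) = 1" if "r \<in> R" for r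
    using q_sum[OF that] k by (intro sum_bits_prob) (auto simp: sum_bool)
  have "(\<Sum>t\<in>bit_vectors (Suc k). \<Sum>r\<in>R. w r * (bits_prob (q r) (Suc k) t *
          ln (bits_prob (q r) (Suc k) t / bits_prob q0 (Suc k) t)))
      = (\<Sum>t\<in>bit_vectors k. \<Sum>b\<in>UNIV. \<Sum>r\<in>R. w r * (?P r t * q r k b * ln (?P r t * q r k b / (?Q t * q0 k b))))"
    by (simp add: sum_bit_vectors_Suc bits_prob_Suc)
  also have "\<dots> = (\<Sum>t\<in>bit_vectors k. \<Sum>b\<in>UNIV. \<Sum>r\<in>R. w r * (?P r t * ln (?P r t / ?Q t) * q r k b
        + ?P r t * (q r k b * ln (q r k b / q0 k b))))"
    by (intro sum.cong refl) (simp only: split)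
  also have "\<dots> = (\<Sum>t\<in>bit_vectors k. \<Sum>r\<in>R. \<Sum>b\<in>UNIV. w r * (?P r t * ln (?P r t / ?Q t) * q r k b
        + ?P r t * (q r k b * ln (q r k b / q0 k b))))"
    by (intro sum.cong refl sum.swap)
  also have "\<dots> = (\<Sum>t\<in>bit_vectors k. \<Sum>r\<in>R. w r * (?P r t * ln (?P r t / ?Q t)) * (\<Sum>b\<in>UNIV. q r k b)
        + ?P r t * (w r * (\<Sum>b\<in>UNIV. q r k b * ln (q r k b / q0 k b))))"
    by (intro sum.cong refl) (simp add: sum_distrib_left sum.distrib algebra_simps sum_bool)
  also have "\<dots> = (\<Sum>t\<in>bit_vectors k. \<Sum>r\<in>R. w r * (?P r t * ln (?P r t / ?Q t)))
        + (\<Sum>t\<in>bit_vectors k. \<Sum>r\<in>R. ?P r t * (w r * (\<Sum>b\<in>UNIV. q r k b * ln (q r k b / q0 k b))))"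
    by (simp add: qs sum.distrib)
  also have "(\<Sum>t\<in>bit_vectors k. \<Sum>r\<in>R. ?P r t * (w r * (\<Sum>b\<in>UNIV. q r k b * ln (q r k b / q0 k b))))
      = (\<Sum>r\<in>R. w r * (\<Sum>b\<in>UNIV. q r k b * ln (q r k b / q0 k b)))"
    by (subst sum.swap) (simp add: Ps flip: sum_distrib_right)
  also have "\<dots> \<le> \<eta>" by (rule relative_entropy_le[OF k(1)])
  also have "(\<Sum>t\<in>bit_vectors k. \<Sum>r\<in>R. w r * (?P r t * ln (?P r t / ?Q t))) \<le> k * \<eta>"
    by (rule Suc.IH[OF k(2)])
  finally show ?case by (simp add: algebra_simps)
qed

section \<open>The law of the bits averaged over the prior\<close>

definition mixture :: "nat \<Rightarrow> (nat \<Rightarrow> bool) \<Rightarrow> real" where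
  "mixture k t = (\<Sum>r\<in>R. w r * bits_prob (q r) k t)"

lemma bits_nonneg: "r \<in> R \<Longrightarrow> k \<le> m \<Longrightarrow> 0 \<le> bits_prob (q r) k t"
  using q_nonneg by (intro bits_prob_nonneg) auto

lemma mixture_nonneg: "k \<le> m \<Longrightarrow> 0 \<le> mixture k t"
  unfolding mixture_def using bits_nonneg w_pos by (intro sum_nonneg mult_nonneg_nonneg) (auto simp: less_imp_le)

lemma mixture_eq_0:
  assumes "k \<le> m" "mixture k t = 0" "r \<in> R"
  shows "bits_prob (q r) k t = 0"
proof -
  have "w r * bits_prob (q r) k t = 0"
    using assms bits_nonneg w_pos finite_R unfolding mixture_def
    by (subst (asm) sum_nonneg_eq_0_iff) (auto simp: less_imp_le)
  then show ?thesis using w_pos[OF assms(3)] by simp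
qed

lemma sum_mixture: "k \<le> m \<Longrightarrow> (\<Sum>t\<in>bit_vectors k. mixture k t) = 1"
proof -
  assume k: "k \<le> m"
  have "(\<Sum>t\<in>bit_vectors k. mixture k t) = (\<Sum>r\<in>R. w r * (\<Sum>t\<in>bit_vectors k. bits_prob (q r) k t))"
    unfolding mixture_def by (subst sum.swap) (simp add: sum_distrib_left)
  also have "\<dots> = (\<Sum>r\<in>R. w r)"
  proof (intro sum.cong refl)
    fix r assume "r \<in> R"
    then have "(\<Sum>t\<in>bit_vectors k. bits_prob (q r) k t) = 1"
      using q_sum k by (intro sum_bits_prob) (auto simp: sum_bool)
    then show "w r * (\<Sum>t\<in>bit_vectors k. bits_prob (q r) k t) = w r" by simp
  qed
  finally show ?thesis using sum_w by simp
qed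

text \<open>The mutual information of parameter and bits is at most the average relative entropy with
  respect to any product law, here \<open>q0\<close>; this makes it subadditive in the machines.\<close>

lemma information_le:
  assumes k: "k \<le> m"
  shows "(\<Sum>t\<in>bit_vectors k. \<Sum>r\<in>R. w r * (bits_prob (q r) k t * ln (bits_prob (q r) k t / mixture k t)))
    \<le> k * \<eta>"
proof -
  let ?P = "\<lambda>r t. bits_prob (q r) k t" and ?Q = "\<lambda>t. bits_prob q0 k t"
  \<comment> \<open>For fixed \<open>t\<close>, replacing \<open>mixture\<close> by the product law
    inside the logarithm changes the sum by \<open>mixture k t * ln (?Q t / mixture k t)\<close>,
    which is at most \<open>?Q t - mixture k t\<close>. This correction sums to 0, since both are
    probability laws.\<close>
  have *: "(\<Sum>r\<in>R. w r * (?P r t * ln (?P r t / mixture k t)))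
      \<le> (\<Sum>r\<in>R. w r * (?P r t * ln (?P r t / ?Q t))) - mixture k t + ?Q t" for t
  proof (cases "mixture k t = 0")
    case True
    then have "\<And>r. r \<in> R \<Longrightarrow> ?P r t = 0" using mixture_eq_0[OF k] by blast
    then show ?thesis using True q0_nonneg k by (simp add: bits_prob_nonneg)
  next
    case False
    then have mp: "mixture k t > 0" using mixture_nonneg[OF k, of t] by linarith
    have P0: "?Q t > 0"
    proof -
      have "?Q t \<noteq> 0"
        using False abs_cont_bits[OF _ k] unfolding mixture_def by (metis (no_types, lifting) mult_zero_right sum.neutral)
      moreover have "?Q t \<ge> 0" using q0_nonneg k by (simp add: bits_prob_nonneg)
      ultimately show ?thesis by linarith
    qed
    have e: "?P r t * ln (?P r t / mixture k t)
        = ?P r t * ln (?P r t / ?Q t) + ?P r t * ln (?Q t / mixture k t)" if "r \<in> R" for r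
    proof (cases "?P r t = 0")
      case F: False
      then have "?P r t > 0" using bits_nonneg[OF that k, of t] by linarith
      then show ?thesis using mp P0 by (simp add: ln_div algebra_simps)
    qed simp
    have "(\<Sum>r\<in>R. w r * (?P r t * ln (?P r t / mixture k t)))
        = (\<Sum>r\<in>R. w r * (?P r t * ln (?P r t / ?Q t))) + mixture k t * ln (?Q t / mixture k t)"
    proof -
      have "(\<Sum>r\<in>R. w r * (?P r t * ln (?P r t / mixture k t)))
          = (\<Sum>r\<in>R. w r * (?P r t * ln (?P r t / ?Q t) + ?P r t * ln (?Q t / mixture k t)))"
        by (intro sum.cong refl) (simp only: e)
      also have "\<dots> = (\<Sum>r\<in>R. w r * (?P r t * ln (?P r t / ?Q t)))
          + (\<Sum>r\<in>R. w r * ?P r t) * ln (?Q t / mixture k t)"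
        by (simp only: distrib_left sum.distrib sum_distrib_right mult.assoc)
      finally show ?thesis by (simp add: mixture_def)
    qed
    moreover have "mixture k t * ln (?Q t / mixture k t) \<le> mixture k t * (?Q t / mixture k t - 1)"
      using mp P0 by (intro mult_left_mono ln_le_minus_one) auto
    ultimately show ?thesis using mp by (simp add: algebra_simps)
  qed
  have P0s: "(\<Sum>t\<in>bit_vectors k. ?Q t) = 1"
    using q0_sum k by (intro sum_bits_prob) (auto simp: sum_bool)
  have "(\<Sum>t\<in>bit_vectors k. \<Sum>r\<in>R. w r * (?P r t * ln (?P r t / mixture k t)))
      \<le> (\<Sum>t\<in>bit_vectors k. (\<Sum>r\<in>R. w r * (?P r t * ln (?P r t / ?Q t))) - mixture k t + ?Q t)"
    by (intro sum_mono *)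
  also have "\<dots> = (\<Sum>t\<in>bit_vectors k. \<Sum>r\<in>R. w r * (?P r t * ln (?P r t / ?Q t)))"
    using sum_mixture[OF k] P0s by (simp add: sum.distrib sum_subtractf)
  also have "\<dots> \<le> k * \<eta>" by (rule relative_entropy_bits_le[OF k])
  finally show ?thesis .
qed

text \<open>The relative entropy of \<open>mixture k\<close> from the product law, bounded in dual
  form. In the chain rule, machine \<open>j\<close> costs \<open>\<kappa>\<close> times the
  information in the \<open>j\<close> previous bits, at most \<open>j * \<eta>\<close>, plus
  \<open>\<delta>\<close>. Quantifying over all \<open>g\<close> lets the induction integrate out
  the last bit and continue with a new function.\<close>

lemma mixture_le_product:
  assumes "k \<le> m"
  shows "(\<Sum>t\<in>bit_vectors k. mixture k t * g t)
    \<le> ln (\<Sum>t\<in>bit_vectors k. bits_prob q0 k t * exp (g t)) + (\<Sum>j<k. \<kappa> * (real j * \<eta>) + \<delta>)"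
  using assms
proof (induction k arbitrary: g)
  case 0
  then show ?case by (simp add: mixture_def bits_prob_def sum_w)
next
  case (Suc k)
  let ?P = "\<lambda>r t. bits_prob (q r) k t" and ?Q = "\<lambda>t. bits_prob q0 k t"
  have k: "k < m" "k \<le> m" using Suc.prems by auto
  \<comment> \<open>The logarithmic moment of \<open>g\<close> over the last bit: the
    \<open>q0\<close>-mean of \<open>exp (G t)\<close> over \<open>k\<close> bits is that of
    \<open>exp (g t)\<close> over \<open>Suc k\<close> bits.\<close>
  define G where "G = (\<lambda>t. ln (\<Sum>b\<in>UNIV. q0 k b * exp (g (t(k := b)))))"
  define H where "H = (\<lambda>t. \<Sum>r\<in>R. w r * (?P r t * ln (?P r t / mixture k t)))"
  have step: "(\<Sum>b\<in>UNIV. mixture (Suc k) (t(k := b)) * g (t(k := b)))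
      \<le> mixture k t * G t + \<kappa> * H t + mixture k t * \<delta>" for t
  proof (cases "mixture k t = 0")
    case True
    then have "\<And>r. r \<in> R \<Longrightarrow> ?P r t = 0" using mixture_eq_0[OF k(2)] by blast
    then show ?thesis using True by (simp add: H_def mixture_def bits_prob_Suc)
  next
    case False
    then have mp: "mixture k t > 0" using mixture_nonneg[OF k(2), of t] by linarith
    \<comment> \<open>The density of the posterior given the first \<open>k\<close> bits with
      respect to the prior. Weighted by \<open>mixture k t\<close>, its entropy is
      \<open>H t\<close>, and the sum of \<open>H\<close> is the mutual information bounded in
      \<open>information_le\<close>.\<close>
    define h where "h = (\<lambda>r. ?P r t / mixture k t)"
    have "(\<Sum>b\<in>UNIV. (\<Sum>r\<in>R. w r * (h r * q r k b)) * g (t(k := b)))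
        \<le> G t + \<kappa> * (\<Sum>r\<in>R. w r * (h r * ln (h r))) + \<delta>"
      unfolding G_def
    proof (rule transport[OF k(1)])
      show "0 \<le> h r" if "r \<in> R" for r using bits_nonneg[OF that k(2)] mp by (simp add: h_def)
      have "(\<Sum>r\<in>R. w r * h r) = (\<Sum>r\<in>R. w r * ?P r t) / mixture k t"
        by (simp add: h_def sum_divide_distrib)
      also have "\<dots> = mixture k t / mixture k t" by (simp add: mixture_def)
      finally have "(\<Sum>r\<in>R. w r * h r) = mixture k t / mixture k t" .
      then show "(\<Sum>r\<in>R. w r * h r) = 1" using mp by simp
    qed
    then have "mixture k t * (\<Sum>b\<in>UNIV. (\<Sum>r\<in>R. w r * (h r * q r k b)) * g (t(k := b)))
        \<le> mixture k t * (G t + \<kappa> * (\<Sum>r\<in>R. w r * (h r * ln (h r))) + \<delta>)"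
      using mp by (intro mult_left_mono) auto
    moreover have "mixture k t * (\<Sum>b\<in>UNIV. (\<Sum>r\<in>R. w r * (h r * q r k b)) * g (t(k := b)))
        = (\<Sum>b\<in>UNIV. (\<Sum>r\<in>R. w r * (mixture k t * h r * q r k b)) * g (t(k := b)))"
      by (simp add: sum_distrib_left mult_ac)
    moreover have "mixture k t * (\<Sum>r\<in>R. w r * (h r * ln (h r))) = (\<Sum>r\<in>R. w r * (mixture k t * h r * ln (h r)))"
      by (simp add: sum_distrib_left mult_ac)
    moreover have "mixture k t * h r = ?P r t" for r using mp by (simp add: h_def)
    ultimately show ?thesis
      by (simp add: H_def h_def mixture_def[of "Suc k"] bits_prob_Suc algebra_simps)
  qed
  have q0b: "(\<Sum>b\<in>UNIV. q0 k b * exp (g (t(k := b)))) > 0" for t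
  proof -
    have "q0 k True > 0 \<or> q0 k False > 0"
      using q0_sum[OF k(1)] q0_nonneg[OF k(1)] by (smt (verit))
    then show ?thesis using q0_nonneg[OF k(1)] by (auto simp: sum_bool intro: add_pos_nonneg add_nonneg_pos)
  qed
  have "(\<Sum>t\<in>bit_vectors (Suc k). mixture (Suc k) t * g t)
      = (\<Sum>t\<in>bit_vectors k. \<Sum>b\<in>UNIV. mixture (Suc k) (t(k := b)) * g (t(k := b)))"
    by (rule sum_bit_vectors_Suc)
  also have "\<dots> \<le> (\<Sum>t\<in>bit_vectors k. mixture k t * G t + \<kappa> * H t + mixture k t * \<delta>)"
    by (intro sum_mono step)
  also have "\<dots> = (\<Sum>t\<in>bit_vectors k. mixture k t * G t) + \<kappa> * (\<Sum>t\<in>bit_vectors k. H t) + \<delta>"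
    using sum_mixture[OF k(2)] by (simp add: sum.distrib sum_distrib_left flip: sum_distrib_right)
  also have "(\<Sum>t\<in>bit_vectors k. H t) \<le> k * \<eta>" unfolding H_def by (rule information_le[OF k(2)])
  also have "(\<Sum>t\<in>bit_vectors k. mixture k t * G t)
      \<le> ln (\<Sum>t\<in>bit_vectors k. ?Q t * exp (G t)) + (\<Sum>j<k. \<kappa> * (real j * \<eta>) + \<delta>)"
    by (rule Suc.IH[OF k(2)])
  also have "(\<Sum>t\<in>bit_vectors k. ?Q t * exp (G t)) = (\<Sum>t\<in>bit_vectors (Suc k). bits_prob q0 (Suc k) t * exp (g t))"
    using q0b by (simp add: sum_bit_vectors_Suc bits_prob_Suc G_def sum_distrib_left mult_ac)
  finally show ?case using kappa_nonneg by (simp add: mult_left_mono)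
qed

end

section \<open>Quadratic forms on the cube\<close>

text \<open>A sign vector is encoded by the set of its positive coordinates, so that the cube is
  \<open>Pow I\<close> and induction on \<open>I\<close> adds one coordinate.\<close>

definition sgn_in :: "'i set \<Rightarrow> 'i \<Rightarrow> real" where
  "sgn_in A i = (if i \<in> A then 1 else -1)"

text \<open>The kernel is a tensor power of the matrix with diagonal \<open>a + b\<close> and
  off-diagonal \<open>a - b\<close>. For \<open>a = cosh t\<close> and \<open>b = sinh t\<close> it
  is \<open>exp (t * \<langle>A, B\<rangle>)\<close>, the Gram matrix of the Gaussian likelihood
  ratios when \<open>t = s\<^sup>2\<close>.\<close>

definition cube_form :: "real \<Rightarrow> real \<Rightarrow> 'i set \<Rightarrow> ('i set \<Rightarrow> real) \<Rightarrow> ('i set \<Rightarrow> real) \<Rightarrow> real" where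
  "cube_form a b I \<phi> \<psi> =
    (\<Sum>A\<in>Pow I. \<Sum>B\<in>Pow I. \<phi> A * \<psi> B * (\<Prod>i\<in>I. a + b * (sgn_in A i * sgn_in B i)))"

lemma sum_Pow_insert:
  assumes "finite I" "i \<notin> I"
  shows "(\<Sum>A\<in>Pow (insert i I). F A) = (\<Sum>A\<in>Pow I. F A) + (\<Sum>A\<in>Pow I. F (insert i A))"
proof -
  have "inj_on (insert i) (Pow I)" using assms(2) by (auto simp: inj_on_def)
  then have "(\<Sum>A\<in>insert i ` Pow I. F A) = (\<Sum>A\<in>Pow I. F (insert i A))"
    by (simp add: sum.reindex)
  moreover have "Pow I \<inter> insert i ` Pow I = {}" using assms(2) by auto
  ultimately show ?thesis
    using assms(1) by (simp add: Pow_insert sum.union_disjoint)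
qed

text \<open>Splitting off coordinate \<open>i\<close> diagonalises its two-by-two factor: the even
  part of \<open>\<phi>\<close> in this coordinate is weighted by \<open>a\<close>, the odd part by
  \<open>b\<close>.\<close>

lemma cube_form_insert:
  assumes I: "finite I" "i \<notin> I"
  shows "cube_form a b (insert i I) \<phi> \<phi>
    = a * cube_form a b I (\<lambda>A. \<phi> (insert i A) + \<phi> A) (\<lambda>A. \<phi> (insert i A) + \<phi> A)
    + b * cube_form a b I (\<lambda>A. \<phi> (insert i A) - \<phi> A) (\<lambda>A. \<phi> (insert i A) - \<phi> A)"
proof -
  define p where "p A B = (\<Prod>j\<in>I. a + b * (sgn_in A j * sgn_in B j))" for A B
  have p: "(\<Prod>j\<in>insert i I. a + b * (sgn_in A j * sgn_in B j)) = (a + b * (sgn_in A i * sgn_in B i)) * p A B" for A B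
    using I by (simp add: p_def)
  have pi: "p (insert i A) B = p A B" "p A (insert i B) = p A B" for A B
    unfolding p_def using I by (auto intro!: prod.cong simp: sgn_in_def)
  have s: "sgn_in (insert i A) i = 1" for A by (simp add: sgn_in_def)
  have s': "sgn_in A i = -1" if "A \<in> Pow I" for A using that I by (auto simp: sgn_in_def)
  have "cube_form a b (insert i I) \<phi> \<phi>
      = (\<Sum>A\<in>Pow I. \<Sum>B\<in>Pow I. \<phi> A * \<phi> B * ((a + b) * p A B))
      + (\<Sum>A\<in>Pow I. \<Sum>B\<in>Pow I. \<phi> A * \<phi> (insert i B) * ((a - b) * p A B))
      + ((\<Sum>A\<in>Pow I. \<Sum>B\<in>Pow I. \<phi> (insert i A) * \<phi> B * ((a - b) * p A B))
      + (\<Sum>A\<in>Pow I. \<Sum>B\<in>Pow I. \<phi> (insert i A) * \<phi> (insert i B) * ((a + b) * p A B)))"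
    unfolding cube_form_def p sum_Pow_insert[OF I] sum.distrib by (simp add: pi s s')
  also have "\<dots> = (\<Sum>A\<in>Pow I. \<Sum>B\<in>Pow I.
        a * ((\<phi> (insert i A) + \<phi> A) * (\<phi> (insert i B) + \<phi> B) * p A B)
      + b * ((\<phi> (insert i A) - \<phi> A) * (\<phi> (insert i B) - \<phi> B) * p A B))"
    unfolding sum.distrib[symmetric] by (intro sum.cong refl) (simp add: algebra_simps)
  also have "\<dots> = a * cube_form a b I (\<lambda>A. \<phi> (insert i A) + \<phi> A) (\<lambda>A. \<phi> (insert i A) + \<phi> A)
    + b * cube_form a b I (\<lambda>A. \<phi> (insert i A) - \<phi> A) (\<lambda>A. \<phi> (insert i A) - \<phi> A)"
    by (simp add: cube_form_def p_def sum.distrib sum_distrib_left)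
  finally show ?thesis .
qed

lemma sum_sq_le_card:
  fixes \<phi> :: "'a \<Rightarrow> real"
  shows "(\<Sum>x\<in>S. \<phi> x)\<^sup>2 \<le> card S * (\<Sum>x\<in>S. (\<phi> x)\<^sup>2)"
  using sum_squared_le_sum_of_squares[of \<phi> S] by (cases "finite S") (auto simp: mult.commute)

text \<open>The parity functions diagonalise the form: its eigenvalues are \<open>a^(n-k) * b^k\<close>, the constant
  function having eigenvalue \<open>a^n\<close>.\<close>

lemma cube_form_le:
  fixes a b :: real
  assumes "finite I" and ab: "1 \<le> a" "0 \<le> b" "b \<le> 1"
  shows "cube_form a b I \<phi> \<phi> \<le> a ^ card I * (\<Sum>A\<in>Pow I. \<phi> A)\<^sup>2
    + a ^ card I * b * (2 ^ card I * (\<Sum>A\<in>Pow I. (\<phi> A)\<^sup>2) - (\<Sum>A\<in>Pow I. \<phi> A)\<^sup>2)"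
  using assms(1)
proof (induction I arbitrary: \<phi> rule: finite_induct)
  case empty
  then show ?case by (simp add: cube_form_def power2_eq_square)
next
  case (insert i I)
  define u where "u = (\<lambda>A. \<phi> (insert i A) + \<phi> A)"
  define v where "v = (\<lambda>A. \<phi> (insert i A) - \<phi> A)"
  define n where "n = card I"
  define N :: real where "N = 2 ^ n"
  define U U2 V V2 where "U = (\<Sum>A\<in>Pow I. u A)" and "U2 = (\<Sum>A\<in>Pow I. (u A)\<^sup>2)"
    and "V = (\<Sum>A\<in>Pow I. v A)" and "V2 = (\<Sum>A\<in>Pow I. (v A)\<^sup>2)"
  have cardPow: "real (card (Pow I)) = N" using insert.hyps by (simp add: card_Pow N_def n_def)
  have UV: "U\<^sup>2 \<le> N * U2" "V\<^sup>2 \<le> N * V2"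
    using sum_sq_le_card[of u "Pow I"] sum_sq_le_card[of v "Pow I"] cardPow
    by (simp_all add: U_def U2_def V_def V2_def)
  have an: "1 \<le> a ^ n" using ab by simp
  have S: "(\<Sum>A\<in>Pow (insert i I). \<phi> A) = U"
    using insert.hyps by (simp add: sum_Pow_insert U_def u_def sum.distrib)
  have S2: "2 * (\<Sum>A\<in>Pow (insert i I). (\<phi> A)\<^sup>2) = U2 + V2"
    using insert.hyps
    by (simp add: sum_Pow_insert U2_def V2_def u_def v_def power2_eq_square algebra_simps
        sum.distrib sum_subtractf sum_distrib_left)
  have u: "cube_form a b I u u \<le> a ^ n * U\<^sup>2 + a ^ n * b * (N * U2 - U\<^sup>2)"
    using insert.IH[of u] by (simp add: n_def N_def U_def U2_def)
  have "cube_form a b I v v \<le> a ^ n * V\<^sup>2 + a ^ n * b * (N * V2 - V\<^sup>2)"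
    using insert.IH[of v] by (simp add: n_def N_def V_def V2_def)
  \<comment> \<open>The odd part already has a factor \<open>b\<close> in the recursion, so the
    crude bound \<open>b \<le> 1\<close> suffices here. A further factor \<open>a\<close> is
    inserted below to match the exponent of the even part.\<close>
  also have "\<dots> \<le> a ^ n * V\<^sup>2 + a ^ n * 1 * (N * V2 - V\<^sup>2)"
    using ab an UV by (intro add_left_mono mult_right_mono mult_left_mono) auto
  also have "\<dots> = a ^ n * (N * V2)" by (simp add: algebra_simps)
  also have "\<dots> \<le> a * (a ^ n * (N * V2))"
  proof -
    have "0 \<le> N * V2" using UV(2) by (smt (verit) zero_le_power2)
    then show ?thesis using ab by (intro mult_left_mono[of 1 a, simplified] mult_right_mono[of 1 a, simplified]) auto
  qed
  finally have v: "cube_form a b I v v \<le> a * (a ^ n * (N * V2))" .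
  have "cube_form a b (insert i I) \<phi> \<phi> = a * cube_form a b I u u + b * cube_form a b I v v"
    using cube_form_insert[OF insert.hyps] by (simp add: u_def v_def)
  also have "\<dots> \<le> a * (a ^ n * U\<^sup>2 + a ^ n * b * (N * U2 - U\<^sup>2)) + b * (a * (a ^ n * (N * V2)))"
    using u v ab by (intro add_mono mult_left_mono) auto
  also have "\<dots> = a ^ Suc n * U\<^sup>2 + a ^ Suc n * b * (N * (U2 + V2) - U\<^sup>2)"
    by (simp add: algebra_simps)
  also have "U2 + V2 = 2 * (\<Sum>A\<in>Pow (insert i I). (\<phi> A)\<^sup>2)" using S2 by simp
  also have "U = (\<Sum>A\<in>Pow (insert i I). \<phi> A)" using S by simp
  finally show ?case using insert.hyps by (simp add: n_def N_def mult_ac)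
qed

section \<open>Elementary bounds for hyperbolic functions\<close>

lemma exp_sgn: "exp (t * (sgn_in A i * sgn_in B i)) = cosh t + sinh t * (sgn_in A i * sgn_in B i)" for t :: real
  by (simp add: sgn_in_def cosh_plus_sinh cosh_minus_sinh)

text \<open>Termwise comparison of power series, which reduces to
  \<open>fact n * 2 ^ n \<le> fact (2 * n)\<close>.\<close>

lemma cosh_le_exp_half_square: "cosh (x::real) \<le> exp (x\<^sup>2 / 2)"
proof -
  have sc: "y /\<^sub>R fact n = y / fact n" for y :: real and n
    by (metis divide_inverse_commute real_scaleR_def)
  have c: "(\<lambda>n. (x\<^sup>2 / 2) ^ n / fact n) sums exp (x\<^sup>2 / 2)"
    using exp_converges[of "x\<^sup>2 / 2"] unfolding sc .
  have "(\<lambda>n. if even n then x ^ n / fact n else 0) sums cosh x"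
    using cosh_converges[of x] unfolding sc .
  moreover have "strict_mono ((*) (2 :: nat))" by (auto simp: strict_mono_def)
  ultimately have "(\<lambda>n. if even (2 * n) then x ^ (2 * n) / fact (2 * n) else 0) sums cosh x"
    by (subst sums_mono_reindex[of "(*) 2" "\<lambda>n. if even n then x ^ n / fact n else 0"]) (auto elim!: evenE)
  then have d: "(\<lambda>n. x ^ (2 * n) / fact (2 * n)) sums cosh x" by simp
  have f: "fact n * 2 ^ n \<le> (fact (2 * n) :: real)" for n
  proof (induction n)
    case (Suc n)
    have "fact (Suc n) * 2 ^ Suc n = (2 * (real n + 1)) * (fact n * 2 ^ n)" by (simp add: algebra_simps)
    also have "\<dots> \<le> (2 * (real n + 1)) * fact (2 * n)" using Suc by (intro mult_left_mono) auto
    also have "\<dots> \<le> (2 * real n + 2) * ((2 * real n + 1) * fact (2 * n))"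
      by (intro mult_mono) (auto intro: mult_right_mono[of 1, simplified])
    also have "\<dots> = fact (2 * Suc n)" by (simp add: algebra_simps)
    finally show ?case .
  qed simp
  show ?thesis
  proof (rule sums_le[OF _ d c])
    fix n
    have "x ^ (2 * n) / fact (2 * n) \<le> x ^ (2 * n) / (fact n * 2 ^ n)"
      using f[of n] by (intro divide_left_mono) (auto simp: power_mult)
    also have "x ^ (2 * n) / (fact n * 2 ^ n) = (x\<^sup>2 / 2) ^ n / fact n"
      by (simp only: power_mult power_divide divide_divide_eq_left mult.commute[of "fact n"])
    finally show "x ^ (2 * n) / fact (2 * n) \<le> (x\<^sup>2 / 2) ^ n / fact n" .
  qed
qed

lemma sinh_le_two_times: "0 \<le> t \<Longrightarrow> t \<le> 1 \<Longrightarrow> sinh t \<le> 2 * t" for t :: real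
proof -
  assume t: "0 \<le> t" "t \<le> 1"
  have "exp t \<le> 1 + t + t\<^sup>2" using exp_bound t by blast
  moreover have "exp (- t) \<ge> 1 - t" using exp_ge_add_one_self[of "-t"] by simp
  moreover have "t\<^sup>2 \<le> t" using t by (simp add: power2_eq_square mult_left_le_one_le)
  ultimately show ?thesis using t by (simp add: sinh_def)
qed

lemma cosh_le_one_plus_square: "\<bar>t\<bar> \<le> 1 \<Longrightarrow> cosh t \<le> 1 + t\<^sup>2" for t :: real
proof -
  assume t: "\<bar>t\<bar> \<le> 1"
  have u: "0 \<le> t\<^sup>2 / 2" "t\<^sup>2 / 2 \<le> 1"  "t\<^sup>2 \<le> 1" using abs_square_le_1[of t] t by auto
  have "cosh t \<le> exp (t\<^sup>2 / 2)" by (rule cosh_le_exp_half_square)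
  also have "\<dots> \<le> 1 + t\<^sup>2/2 + (t\<^sup>2/2)\<^sup>2" using exp_bound[OF u(1,2)] .
  also have "(t\<^sup>2/2)\<^sup>2 = (t\<^sup>2/2) * (t\<^sup>2/2)" by (simp add: power2_eq_square)
  also have "\<dots> \<le> (t\<^sup>2/2) * 1" using u by (intro mult_left_mono) auto
  finally show ?thesis by simp
qed

text \<open>A quadratic minorant of the convex conjugate of \<open>ln cosh\<close>, i.e. of the entropy of a bit\<close>

lemma ln_cosh_conjugate: "\<exists>a::real. \<bar>a\<bar> \<le> 1 \<and> ln (cosh y) \<le> a * y - a\<^sup>2 / 4"
proof (cases "\<bar>y\<bar> \<le> 1")
  \<comment> \<open>The witness is \<open>a = y\<close>: what is left is y^2/2 \<le> 3
    y^2/4.\<close>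
  case True
  have "ln (cosh y) \<le> ln (exp (y\<^sup>2 / 2))"
    using cosh_le_exp_half_square[of y] by (subst ln_le_cancel_iff) auto
  also have "\<dots> \<le> y * y - y\<^sup>2 / 4" by (simp add: power2_eq_square)
  finally show ?thesis using True by blast
next
  \<comment> \<open>The witness is \<open>a = sgn y\<close>, so
    \<open>ln (cosh y) \<le> \<bar>y\<bar> - 1 / 4\<close> is needed. It holds because
    \<open>(1 + exp (- (2 * \<bar>y\<bar>))) / 2 \<le> 2 / 3\<close>, which is below 3/4 and hence
    below \<open>exp (- (1 / 4))\<close>.\<close>
  case False
  have "1 + 2 * \<bar>y\<bar> \<le> exp (2 * \<bar>y\<bar>)" by (rule exp_ge_add_one_self)
  then have "3 \<le> exp (2 * \<bar>y\<bar>)" using False by linarith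
  then have e2: "exp (- (2 * \<bar>y\<bar>)) \<le> 1 / 3" by (simp add: exp_minus field_simps)
  have e: "3 / 4 \<le> exp (- (1 / 4) :: real)" using exp_ge_add_one_self[of "- (1/4) :: real"] by simp
  have "cosh y = cosh \<bar>y\<bar>" by simp
  also have "\<dots> = exp \<bar>y\<bar> * ((1 + exp (- (2 * \<bar>y\<bar>))) / 2)"
    by (simp only: cosh_field_def distrib_left times_divide_eq_right exp_add[symmetric]) (simp add: exp_add[symmetric])
  also have "\<dots> \<le> exp \<bar>y\<bar> * exp (- (1 / 4))"
    using e e2 by (intro mult_left_mono) auto
  also have "\<dots> = exp (\<bar>y\<bar> - 1 / 4)" by (simp flip: exp_add)
  finally have "ln (cosh y) \<le> ln (exp (\<bar>y\<bar> - 1 / 4))" by (subst ln_le_cancel_iff) auto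
  then show ?thesis
    by (intro exI[of _ "sgn y"]) (auto simp: sgn_if abs_if split: if_splits)
qed

section \<open>Gaussian shifts\<close>

definition gauss :: "real \<Rightarrow> real measure" where
  "gauss v = density lborel (normal_density v 1)"

text \<open>The likelihood ratio of \<open>gauss v\<close> with respect to \<open>gauss 0\<close>;
  all shifted laws are treated as densities over the centred one.\<close>

definition tilt :: "real \<Rightarrow> real \<Rightarrow> real" where
  "tilt v x = exp (v * x - v\<^sup>2 / 2)"

lemma sets_gauss [simp, measurable_cong]: "sets (gauss v) = sets borel"
  by (simp add: gauss_def)

lemma space_gauss [simp]: "space (gauss v) = UNIV"
  by (simp add: gauss_def)

lemma prob_space_gauss: "prob_space (gauss v)"
  unfolding gauss_def by (rule prob_space_normal_density) simp

interpretation gauss: prob_space "gauss v" for v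
  by (rule prob_space_gauss)

lemma borel_measurable_tilt [measurable]: "tilt v \<in> borel_measurable borel"
  unfolding tilt_def by measurable

lemma tilt_pos [simp]: "0 < tilt v x" and tilt_nonneg [simp]: "0 \<le> tilt v x"
  by (simp_all add: tilt_def)

lemma normal_density_tilt: "normal_density v 1 x = normal_density 0 1 x * tilt v x"
  by (simp add: normal_density_def tilt_def power2_eq_square field_simps flip: exp_add)

lemma gauss_eq_density: "gauss v = density (gauss 0) (tilt v)"
  unfolding gauss_def
  by (subst density_density_eq) (auto simp: normal_density_tilt[of v] ennreal_mult)

lemma integral_gauss:
  fixes f :: "real \<Rightarrow> real"
  assumes [measurable]: "f \<in> borel_measurable borel"
  shows "(\<integral>x. f x \<partial>gauss v) = (\<integral>x. tilt v x * f x \<partial>gauss 0)"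
  by (subst gauss_eq_density) (simp add: integral_density)

lemma integrable_gauss_iff:
  fixes f :: "real \<Rightarrow> real"
  assumes [measurable]: "f \<in> borel_measurable borel"
  shows "integrable (gauss v) f \<longleftrightarrow> integrable (gauss 0) (\<lambda>x. tilt v x * f x)"
  by (subst gauss_eq_density) (simp add: integrable_density)

lemma integrable_tilt [simp, intro]: "integrable (gauss 0) (tilt v)"
  using integrable_gauss_iff[of "\<lambda>_. 1" v] by simp

lemma integral_tilt [simp]: "(\<integral>x. tilt v x \<partial>gauss 0) = 1"
  using integral_gauss[of "\<lambda>_. 1" v] gauss.prob_space[of v] by simp

text \<open>Completing the square. As each tilt has mean 1, products of two tilts have mean
  \<open>exp (u * v)\<close>, the source of the Gram matrix.\<close>

lemma tilt_mult: "tilt u x * tilt v x = exp (u * v) * tilt (u + v) x"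
  by (simp add: tilt_def power2_eq_square field_simps flip: exp_add)

lemma integrable_tilt_mult [simp, intro]: "integrable (gauss 0) (\<lambda>x. tilt u x * tilt v x)"
  by (simp add: tilt_mult)

lemma integral_tilt_mult: "(\<integral>x. tilt u x * tilt v x \<partial>gauss 0) = exp (u * v)"
  by (simp add: tilt_mult)

lemma (in prob_space) ln_integral_exp_bounds:
  fixes f :: "'a \<Rightarrow> real"
  assumes [measurable]: "f \<in> borel_measurable M" and bound: "\<And>x. \<bar>f x\<bar> \<le> C"
  shows "integrable M (\<lambda>x. exp (f x))" "0 < (\<integral>x. exp (f x) \<partial>M)" "\<bar>ln (\<integral>x. exp (f x) \<partial>M)\<bar> \<le> C"
proof -
  have b: "f x \<le> C" "- C \<le> f x" for x using bound[of x] by auto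
  show i: "integrable M (\<lambda>x. exp (f x))"
    using b by (intro integrable_const_bound[where B = "exp C"]) auto
  have "(\<integral>x. exp (- C) \<partial>M) \<le> (\<integral>x. exp (f x) \<partial>M)" "(\<integral>x. exp (f x) \<partial>M) \<le> (\<integral>x. exp C \<partial>M)"
    by (intro integral_mono; use i b in simp)+
  then have E: "exp (- C) \<le> (\<integral>x. exp (f x) \<partial>M)" "(\<integral>x. exp (f x) \<partial>M) \<le> exp C"
    by (simp_all add: prob_space)
  show pos: "0 < (\<integral>x. exp (f x) \<partial>M)" using E(1) by (smt (verit) exp_gt_zero)
  have "ln (exp (- C)) \<le> ln (\<integral>x. exp (f x) \<partial>M)" "ln (\<integral>x. exp (f x) \<partial>M) \<le> ln (exp C)"
    using E pos by (subst ln_le_cancel_iff; simp)+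
  then show "\<bar>ln (\<integral>x. exp (f x) \<partial>M)\<bar> \<le> C" by simp
qed

text \<open>The variational inequality for a density \<open>L\<close>, with its entropy replaced by
  the larger chi-square divergence. It is \<open>young_square\<close> at \<open>f x - ln E\<close>,
  integrated.\<close>

lemma (in prob_space) integral_mult_le_ln_integral_exp:
  fixes f L :: "'a \<Rightarrow> real"
  assumes f: "f \<in> borel_measurable M" "\<And>x. \<bar>f x\<bar> \<le> C"
    and L: "integrable M L" "integrable M (\<lambda>x. (L x)\<^sup>2)" "\<And>x. 0 \<le> L x" "(\<integral>x. L x \<partial>M) = 1"
  shows "(\<integral>x. f x * L x \<partial>M) \<le> ln (\<integral>x. exp (f x) \<partial>M) + ((\<integral>x. (L x)\<^sup>2 \<partial>M) - 1)"
proof -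
  have [measurable]: "f \<in> borel_measurable M" "L \<in> borel_measurable M" using f L by auto
  have fL: "integrable M (\<lambda>x. f x * L x)"
  proof (rule Bochner_Integration.integrable_bound[where f = "\<lambda>x. C * L x"])
    show "AE x in M. norm (f x * L x) \<le> norm (C * L x)"
    proof (intro AE_I2)
      fix x
      have "\<bar>f x\<bar> \<le> \<bar>C\<bar>" using f(2)[of x] by linarith
      then show "norm (f x * L x) \<le> norm (C * L x)" using L(3)[of x] by (simp add: abs_mult mult_right_mono)
    qed
  qed (use L in auto)
  note ef = ln_integral_exp_bounds(1)[OF f]
  define E where "E = (\<integral>x. exp (f x) \<partial>M)"
  have E: "E > 0" unfolding E_def by (rule ln_integral_exp_bounds(2)[OF f])
  have "(\<integral>x. f x * L x \<partial>M) - ln E = (\<integral>x. f x * L x - ln E * L x \<partial>M)"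
    using fL L by simp
  also have "\<dots> \<le> (\<integral>x. (L x)\<^sup>2 - 2 * L x + exp (f x) / E \<partial>M)"
  proof (intro integral_mono)
    show "integrable M (\<lambda>x. f x * L x - ln E * L x)" using fL L by auto
    show "integrable M (\<lambda>x. (L x)\<^sup>2 - 2 * L x + exp (f x) / E)" using L ef by auto
    show "f x * L x - ln E * L x \<le> (L x)\<^sup>2 - 2 * L x + exp (f x) / E" for x
      using young_square[OF L(3), of "f x - ln E" x] E by (simp add: exp_diff algebra_simps)
  qed
  also have "\<dots> = (\<integral>x. (L x)\<^sup>2 \<partial>M) - 2 + E / E"
    using L ef by (simp add: E_def)
  finally show ?thesis using E by (simp add: E_def)
qed

text \<open>Data processing for one coordinate, in exponential form. The mixture of the two shifts
  with mean sign \<open>a\<close> has chi-square divergence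
  \<open>cosh t + a\<^sup>2 * sinh t - 1\<close>, at most
  \<open>t\<^sup>2 + 2 * t * a\<^sup>2\<close> for \<open>t = s\<^sup>2\<close>. The second term is
  \<open>\<kappa> * (a\<^sup>2 / 4)\<close>, which explains the 8 in \<open>\<kappa>\<close>;
  optimising over \<open>a\<close> through \<open>ln_cosh_conjugate\<close> turns the linear
  inequality into an exponential one.\<close>

lemma gauss_transport:
  fixes f :: "real \<Rightarrow> real" and s :: real
  assumes f [measurable]: "f \<in> borel_measurable borel" and bound: "\<And>x. \<bar>f x\<bar> \<le> C"
    and s: "0 < s" "s\<^sup>2 \<le> 1"
  defines "\<kappa> \<equiv> 8 * s\<^sup>2"
  shows "(exp ((\<integral>x. f x \<partial>gauss s) / \<kappa>) + exp ((\<integral>x. f x \<partial>gauss (-s)) / \<kappa>)) / 2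
    \<le> exp ((ln (\<integral>x. exp (f x) \<partial>gauss 0) + (s\<^sup>2)\<^sup>2) / \<kappa>)"
proof -
  define t where "t = s\<^sup>2"
  define Fp where "Fp = (\<integral>x. f x \<partial>gauss s)"
  define Fm where "Fm = (\<integral>x. f x \<partial>gauss (-s))"
  have t: "0 < t" "t \<le> 1" and \<kappa>: "\<kappa> = 8 * t" "\<kappa> > 0" using s by (auto simp: t_def \<kappa>_def)
  \<comment> \<open>Half the gap between the two means in units of \<open>\<kappa>\<close>: the
    average of the two exponentials is the exponential of their midpoint times
    \<open>cosh y\<close>.\<close>
  define y where "y = (Fp - Fm) / (2 * \<kappa>)"
  obtain a where a: "\<bar>a\<bar> \<le> 1" "ln (cosh y) \<le> a * y - a\<^sup>2 / 4" using ln_cosh_conjugate by blast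
  \<comment> \<open>The density of the mixture giving the signs weights \<open>(1 + a) / 2\<close>
    and \<open>(1 - a) / 2\<close>; it is nonnegative because
    \<open>\<bar>a\<bar> \<le> 1\<close>.\<close>
  define L where "L = (\<lambda>x. (1 + a) / 2 * tilt s x + (1 - a) / 2 * tilt (- s) x)"
  have L2: "(L x)\<^sup>2 = (1 + a)\<^sup>2 / 4 * (tilt s x * tilt s x) + (1 - a)\<^sup>2 / 4 * (tilt (-s) x * tilt (-s) x)
      + (1 - a\<^sup>2) / 2 * (tilt s x * tilt (-s) x)" for x
    unfolding L_def by (simp add: power2_eq_square field_simps)
  have bf: "integrable (gauss 0) (\<lambda>x. tilt v x * f x)" for v
    using bound by (subst integrable_gauss_iff[symmetric]) (auto intro!: gauss.integrable_const_bound[where B = C])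
  have iL: "integrable (gauss 0) L" unfolding L_def by auto
  have iL2: "integrable (gauss 0) (\<lambda>x. (L x)\<^sup>2)" unfolding L2 by auto
  have L0: "0 \<le> L x" for x using a by (auto simp: L_def)
  have L1: "(\<integral>x. L x \<partial>gauss 0) = 1" unfolding L_def by (simp add: field_simps)
  have EL2: "(\<integral>x. (L x)\<^sup>2 \<partial>gauss 0) = cosh t + a\<^sup>2 * sinh t"
  proof -
    have "(\<integral>x. (L x)\<^sup>2 \<partial>gauss 0) = (1 + a)\<^sup>2 / 4 * exp t + (1 - a)\<^sup>2 / 4 * exp t + (1 - a\<^sup>2) / 2 * exp (- t)"
      unfolding L2 by (simp add: integral_tilt_mult t_def power2_eq_square)
    then show ?thesis by (simp add: cosh_field_def sinh_field_def power2_eq_square field_simps)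
  qed
  have fL: "f x * L x = (1 + a) / 2 * (tilt s x * f x) + (1 - a) / 2 * (tilt (- s) x * f x)" for x
    by (simp add: L_def algebra_simps)
  have "(1 + a) / 2 * Fp + (1 - a) / 2 * Fm = (\<integral>x. f x * L x \<partial>gauss 0)"
    unfolding Fp_def Fm_def fL integral_gauss[OF f, of s] integral_gauss[OF f, of "-s"]
    using bf[of s] bf[of "-s"] by simp
  also have "\<dots> \<le> ln (\<integral>x. exp (f x) \<partial>gauss 0) + ((\<integral>x. (L x)\<^sup>2 \<partial>gauss 0) - 1)"
    using bound iL iL2 L0 L1 by (intro gauss.integral_mult_le_ln_integral_exp) auto
  also have "\<dots> \<le> ln (\<integral>x. exp (f x) \<partial>gauss 0) + (t\<^sup>2 + a\<^sup>2 * (2 * t))"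
  proof -
    have "a\<^sup>2 * sinh t \<le> a\<^sup>2 * (2 * t)" using sinh_le_two_times[of t] t by (intro mult_left_mono) auto
    then show ?thesis using cosh_le_one_plus_square[of t] t unfolding EL2 by simp
  qed
  finally have main: "(1 + a) / 2 * Fp + (1 - a) / 2 * Fm - \<kappa> * (a\<^sup>2 / 4) \<le> ln (\<integral>x. exp (f x) \<partial>gauss 0) + t\<^sup>2"
    by (simp add: \<kappa>(1) mult_ac)
  have "(exp (Fp / \<kappa>) + exp (Fm / \<kappa>)) / 2 = exp ((Fp + Fm) / (2 * \<kappa>)) * cosh y"
  proof -
    have "Fp / \<kappa> = (Fp + Fm) / (2 * \<kappa>) + y" "Fm / \<kappa> = (Fp + Fm) / (2 * \<kappa>) - y"
      using \<kappa>(2) by (simp_all add: y_def field_simps)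
    then have "exp (Fp / \<kappa>) = exp ((Fp + Fm) / (2 * \<kappa>)) * exp y"
        "exp (Fm / \<kappa>) = exp ((Fp + Fm) / (2 * \<kappa>)) * exp (- y)"
      by (simp_all flip: exp_add)
    then show ?thesis by (simp add: cosh_field_def distrib_left)
  qed
  also have "\<dots> = exp ((Fp + Fm) / (2 * \<kappa>) + ln (cosh y))" by (simp add: exp_add)
  also have "\<dots> \<le> exp ((Fp + Fm) / (2 * \<kappa>) + (a * y - a\<^sup>2 / 4))" using a by simp
  also have "(Fp + Fm) / (2 * \<kappa>) + (a * y - a\<^sup>2 / 4) = ((1 + a) / 2 * Fp + (1 - a) / 2 * Fm - \<kappa> * (a\<^sup>2 / 4)) / \<kappa>"
    using \<kappa>(2) by (simp add: y_def field_simps)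
  also have "exp \<dots> \<le> exp ((ln (\<integral>x. exp (f x) \<partial>gauss 0) + t\<^sup>2) / \<kappa>)"
    using main \<kappa>(2) by (simp add: divide_right_mono)
  finally show ?thesis by (simp add: Fp_def Fm_def t_def)
qed

section \<open>Products of Gaussian shifts and their likelihood ratios\<close>

lemma product_prob_space_gauss: "product_prob_space (\<lambda>i. gauss (v i))"
  by (intro product_prob_spaceI prob_space_gauss)

abbreviation gauss_PiM :: "'i set \<Rightarrow> ('i \<Rightarrow> real) \<Rightarrow> ('i \<Rightarrow> real) measure" where
  "gauss_PiM I v \<equiv> PiM I (\<lambda>i. gauss (v i))"

lemma sets_gauss_PiM [simp, measurable_cong]: "sets (gauss_PiM I v) = sets (PiM I (\<lambda>_. borel))"
  by (intro sets_PiM_cong) auto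

lemma prob_space_gauss_PiM: "prob_space (gauss_PiM I v)"
  by (intro prob_space_PiM prob_space_gauss)

interpretation gauss_PiM: prob_space "gauss_PiM I v" for I v
  by (rule prob_space_gauss_PiM)

lemma gauss_PiM_eq_density:
  assumes "finite I"
  shows "gauss_PiM I v = density (gauss_PiM I (\<lambda>_. 0)) (\<lambda>x. \<Prod>i\<in>I. tilt (v i) (x i))"
proof -
  interpret v: product_prob_space "\<lambda>i. gauss (v i)" by (rule product_prob_space_gauss)
  interpret z: product_prob_space "\<lambda>_ :: 'a. gauss 0" by (rule product_prob_space_gauss)
  show ?thesis
  proof (rule v.PiM_eqI[symmetric, OF assms])
    fix A assume "\<And>i. i \<in> I \<Longrightarrow> A i \<in> sets (gauss (v i))"
    then have A: "A i \<in> sets borel" if "i \<in> I" for i using that by simp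
    have AI: "Pi\<^sub>E I A \<in> sets (PiM I (\<lambda>_. borel))" using assms A by (intro sets_PiM_I_finite) auto
    have "emeasure (density (gauss_PiM I (\<lambda>_. 0)) (\<lambda>x. \<Prod>i\<in>I. tilt (v i) (x i))) (Pi\<^sub>E I A)
        = (\<integral>\<^sup>+x. ennreal (\<Prod>i\<in>I. tilt (v i) (x i)) * indicator (Pi\<^sub>E I A) x \<partial>gauss_PiM I (\<lambda>_. 0))"
      using AI by (intro emeasure_density) auto
    also have "\<dots> = (\<integral>\<^sup>+x. (\<Prod>i\<in>I. ennreal (tilt (v i) (x i)) * indicator (A i) (x i)) \<partial>gauss_PiM I (\<lambda>_. 0))"
    proof (intro nn_integral_cong)
      fix x assume x: "x \<in> space (gauss_PiM I (\<lambda>_. 0))"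
      have "indicator (Pi\<^sub>E I A) x = (\<Prod>i\<in>I. indicator (A i) (x i) :: ennreal)"
      proof (cases "\<forall>i\<in>I. x i \<in> A i")
        case True
        then show ?thesis using x by (auto simp: space_PiM PiE_def indicator_def)
      next
        case False
        then have "(\<Prod>i\<in>I. indicator (A i) (x i) :: ennreal) = 0"
          using assms by (auto simp: prod_zero_iff indicator_def)
        moreover have "x \<notin> Pi\<^sub>E I A" using False by auto
        ultimately show ?thesis by simp
      qed
      then show "ennreal (\<Prod>i\<in>I. tilt (v i) (x i)) * indicator (Pi\<^sub>E I A) x
          = (\<Prod>i\<in>I. ennreal (tilt (v i) (x i)) * indicator (A i) (x i))"
        by (simp add: prod_ennreal prod.distrib)
    qed
    also have "\<dots> = (\<Prod>i\<in>I. \<integral>\<^sup>+x. ennreal (tilt (v i) x) * indicator (A i) x \<partial>gauss 0)"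
      using assms A by (intro z.product_nn_integral_prod) auto
    also have "\<dots> = (\<Prod>i\<in>I. emeasure (gauss (v i)) (A i))"
    proof (intro prod.cong refl)
      fix i assume "i \<in> I"
      then show "(\<integral>\<^sup>+x. ennreal (tilt (v i) x) * indicator (A i) x \<partial>gauss 0) = emeasure (gauss (v i)) (A i)"
        using A[of i] by (subst gauss_eq_density[of "v i"]) (simp add: emeasure_density)
    qed
    finally show "emeasure (density (gauss_PiM I (\<lambda>_. 0)) (\<lambda>x. \<Prod>i\<in>I. tilt (v i) (x i))) (Pi\<^sub>E I A)
        = (\<Prod>i\<in>I. emeasure (gauss (v i)) (A i))" .
  qed simp
qed

lemma integrable_tilt_prod:
  assumes "finite I"
  shows "integrable (gauss_PiM I (\<lambda>_. 0)) (\<lambda>x. \<Prod>i\<in>I. tilt (v i) (x i))"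
proof -
  interpret z: product_prob_space "\<lambda>_ :: 'a. gauss 0" by (rule product_prob_space_gauss)
  show ?thesis using assms by (intro z.product_integrable_prod) auto
qed

lemma integrable_tilt_prod_mult:
  assumes "finite I"
  shows "integrable (gauss_PiM I (\<lambda>_. 0)) (\<lambda>x. (\<Prod>i\<in>I. tilt (u i) (x i)) * (\<Prod>i\<in>I. tilt (v i) (x i)))"
proof -
  interpret z: product_prob_space "\<lambda>_ :: 'a. gauss 0" by (rule product_prob_space_gauss)
  show ?thesis unfolding prod.distrib[symmetric] 
    using assms by (intro z.product_integrable_prod) auto
qed

lemma integral_tilt_prod_mult:
  assumes "finite I"
  shows "(\<integral>x. (\<Prod>i\<in>I. tilt (u i) (x i)) * (\<Prod>i\<in>I. tilt (v i) (x i)) \<partial>gauss_PiM I (\<lambda>_. 0))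
    = (\<Prod>i\<in>I. exp (u i * v i))"
proof -
  interpret z: product_prob_space "\<lambda>_ :: 'a. gauss 0" by (rule product_prob_space_gauss)
  show ?thesis unfolding prod.distrib[symmetric]
    using assms by (subst z.product_integral_prod) (auto simp: integral_tilt_mult)
qed

lemma integral_tilt_prod:
  assumes "finite I"
  shows "(\<integral>x. (\<Prod>i\<in>I. tilt (v i) (x i)) \<partial>gauss_PiM I (\<lambda>_. 0)) = 1"
proof -
  interpret z: product_prob_space "\<lambda>_ :: 'a. gauss 0" by (rule product_prob_space_gauss)
  show ?thesis using assms by (subst z.product_integral_prod) auto
qed

lemma integral_gauss_PiM:
  fixes f :: "('i \<Rightarrow> real) \<Rightarrow> real"
  assumes "finite I" "f \<in> borel_measurable (PiM I (\<lambda>_. borel))"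
  shows "(\<integral>x. f x \<partial>gauss_PiM I v) = (\<integral>x. (\<Prod>i\<in>I. tilt (v i) (x i)) * f x \<partial>gauss_PiM I (\<lambda>_. 0))"
  using assms by (subst gauss_PiM_eq_density) (auto simp: integral_density prod_nonneg)

section \<open>Tensorisation\<close>

text \<open>Convexity of the functional sending \<open>f\<close> to the logarithm of the mean of
  \<open>exp f\<close>, applied to the average over \<open>N\<close>. After subtracting the
  normalisation \<open>g\<close>, Jensen's inequality for \<open>exp\<close> moves the
  \<open>N\<close>-average outside, and Fubini leaves inner integrals equal to 1.\<close>

lemma ln_integral_exp_average:
  fixes f :: "'a \<Rightarrow> 'b \<Rightarrow> real"
  assumes M: "prob_space M" and N: "prob_space N"
    and f [measurable]: "(\<lambda>(x, y). f x y) \<in> borel_measurable (M \<Otimes>\<^sub>M N)" and bound: "\<And>x y. \<bar>f x y\<bar> \<le> C"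
  shows "ln (\<integral>x. exp (\<integral>y. f x y \<partial>N) \<partial>M) \<le> (\<integral>y. ln (\<integral>x. exp (f x y) \<partial>M) \<partial>N)"
proof -
  interpret M: prob_space M by (rule M)
  interpret N: prob_space N by (rule N)
  interpret P: pair_prob_space M N ..
  have bound': "f x y \<le> C" "- C \<le> f x y" for x y using bound[of x y] by auto
  define g where "g = (\<lambda>y. ln (\<integral>x. exp (f x y) \<partial>M))"
  have fm: "f x \<in> borel_measurable N" if "x \<in> space M" for x using that by measurable
  have fm': "(\<lambda>x. f x y) \<in> borel_measurable M" if "y \<in> space N" for y using that by measurable
  note Eb = M.ln_integral_exp_bounds[OF fm' bound]
  have gb: "\<bar>g y\<bar> \<le> C" if "y \<in> space N" for y
    unfolding g_def by (rule Eb(3)[OF that])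
  have gm [measurable]: "g \<in> borel_measurable N" unfolding g_def by measurable
  have gi: "integrable N g" using gb by (intro N.integrable_const_bound[where B = C]) auto
  have fi: "integrable N (f x)" if "x \<in> space M" for x
    using bound fm[OF that] by (intro N.integrable_const_bound[where B = C]) auto
  define G where "G = (\<integral>y. g y \<partial>N)"
  have ebound: "exp (f x y - g y) \<le> exp (2 * C)" if "y \<in> space N" for x y
    using gb[OF that] bound'[of x y] by (simp add: abs_le_iff)
  have jensen: "exp ((\<integral>y. f x y \<partial>N) - G) \<le> (\<integral>y. exp (f x y - g y) \<partial>N)" if x: "x \<in> space M" for x
  proof -
    have "exp (\<integral>y. f x y - g y \<partial>N) \<le> (\<integral>y. exp (f x y - g y) \<partial>N)"
    proof (rule N.jensens_inequality[where I = UNIV])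
      show "integrable N (\<lambda>y. f x y - g y)" using fi[OF x] gi by auto
      show "integrable N (\<lambda>y. exp (f x y - g y))"
        using ebound fm[OF x] by (intro N.integrable_const_bound[where B = "exp (2 * C)"]) auto
      show "convex_on UNIV (exp :: real \<Rightarrow> real)" by (rule exp_convex)
    qed auto
    then show ?thesis using fi[OF x] gi by (simp add: G_def)
  qed
  have pi: "integrable (M \<Otimes>\<^sub>M N) (\<lambda>(x, y). exp (f x y - g y))"
    using ebound by (intro P.integrable_const_bound[where B = "exp (2 * C)"]) (auto simp: space_pair_measure)
  have li: "integrable M (\<lambda>x. exp (\<integral>y. f x y \<partial>N))"
  proof (intro M.integrable_const_bound[where B = "exp C"] AE_I2)
    fix x assume x: "x \<in> space M"
    have "(\<integral>y. f x y \<partial>N) \<le> (\<integral>y. C \<partial>N)" using fi[OF x] bound' by (intro integral_mono) auto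
    then show "norm (exp (\<integral>y. f x y \<partial>N)) \<le> exp C" by (simp add: N.prob_space)
  qed measurable
  have "(\<integral>x. exp (\<integral>y. f x y \<partial>N) \<partial>M) / exp G = (\<integral>x. exp ((\<integral>y. f x y \<partial>N) - G) \<partial>M)"
    by (simp add: exp_diff)
  also have "\<dots> \<le> (\<integral>x. \<integral>y. exp (f x y - g y) \<partial>N \<partial>M)"
    using li P.integrable_fst'[OF pi] jensen by (intro integral_mono) (auto simp: exp_diff)
  also have "\<dots> = (\<integral>y. \<integral>x. exp (f x y - g y) \<partial>M \<partial>N)"
    using P.Fubini_integral[OF pi] by simp
  also have "\<dots> = (\<integral>y. 1 \<partial>N)"
  proof (intro Bochner_Integration.integral_cong refl)
    fix y assume "y \<in> space N"
    then have "0 < (\<integral>x. exp (f x y) \<partial>M)" by (rule Eb(2))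
    then show "(\<integral>x. exp (f x y - g y) \<partial>M) = 1" by (simp add: exp_diff g_def)
  qed
  finally have le: "(\<integral>x. exp (\<integral>y. f x y \<partial>N) \<partial>M) \<le> exp G" by (simp add: N.prob_space field_simps)
  have "(\<integral>x. exp (- C) \<partial>M) \<le> (\<integral>x. exp (\<integral>y. f x y \<partial>N) \<partial>M)"
  proof (intro integral_mono li)
    fix x assume x: "x \<in> space M"
    have "(\<integral>y. - C \<partial>N) \<le> (\<integral>y. f x y \<partial>N)" using fi[OF x] bound' by (intro integral_mono) auto
    then show "exp (- C) \<le> exp (\<integral>y. f x y \<partial>N)" by (simp add: N.prob_space)
  qed simp
  then have "0 < (\<integral>x. exp (\<integral>y. f x y \<partial>N) \<partial>M)" by (simp add: M.prob_space) (smt (verit) exp_gt_zero)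
  then have "ln (\<integral>x. exp (\<integral>y. f x y \<partial>N) \<partial>M) \<le> ln (exp G)" using le by (subst ln_le_cancel_iff) auto
  then show ?thesis by (simp add: G_def g_def)
qed

text \<open>The exponential form tensorises: one coordinate is integrated out, the induction
  hypothesis treats the others for each sign of that coordinate, and \<open>gauss_transport\<close>
  combines the two signs. Each coordinate adds one error \<open>(s\<^sup>2)\<^sup>2\<close>.\<close>

lemma cube_transport:
  fixes f :: "('i \<Rightarrow> real) \<Rightarrow> real" and s :: real
  assumes "finite I" and f: "f \<in> borel_measurable (PiM I (\<lambda>_. borel))" and bound: "\<And>x. \<bar>f x\<bar> \<le> C"
    and s: "0 < s" "s\<^sup>2 \<le> 1"
  defines "\<kappa> \<equiv> 8 * s\<^sup>2"
  shows "(\<Sum>A\<in>Pow I. exp ((\<integral>x. f x \<partial>gauss_PiM I (\<lambda>i. s * sgn_in A i)) / \<kappa>)) / 2 ^ card I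
    \<le> exp ((ln (\<integral>x. exp (f x) \<partial>gauss_PiM I (\<lambda>_. 0)) + card I * (s\<^sup>2)\<^sup>2) / \<kappa>)"
  using assms(1) f bound
proof (induction I arbitrary: f rule: finite_induct)
  case empty
  interpret z: product_prob_space "\<lambda>_ :: 'i. gauss 0" by (rule product_prob_space_gauss)
  show ?case by (simp add: PiM_empty lebesgue_integral_count_space_finite)
next
  case (insert i I)
  note [simp] = insert.hyps
  interpret z: product_prob_space "\<lambda>_ :: 'i. gauss 0" by (rule product_prob_space_gauss)
  have \<kappa>: "\<kappa> > 0" using s by (simp add: \<kappa>_def)
  have f [measurable]: "f \<in> borel_measurable (PiM (insert i I) (\<lambda>_. borel))" by fact
  have C: "\<bar>f x\<bar> \<le> C" for x by (rule insert.prems(2))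
  have C0: "0 \<le> C" using C[of undefined] by linarith
  have upd: "(\<lambda>p. (fst p)(i := snd p)) \<in> PiM I (\<lambda>_. borel) \<Otimes>\<^sub>M borel \<rightarrow>\<^sub>M PiM (insert i I) (\<lambda>_. borel :: real measure)"
    using measurable_add_dim[of i I "\<lambda>_. borel :: real measure"] by (simp add: split_def)
  have fm: "(\<lambda>(x, y). f (x(i := y))) \<in> borel_measurable (PiM I (\<lambda>_. borel) \<Otimes>\<^sub>M borel)"
    unfolding split_def by (rule measurable_compose[OF upd f])
  have fm' [measurable]: "(\<lambda>(x, y). f (x(i := y))) \<in> borel_measurable (gauss_PiM I u \<Otimes>\<^sub>M gauss v)" for u v
    using fm by (subst measurable_cong_sets[OF sets_pair_measure_cong[OF sets_gauss_PiM sets_gauss] refl])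
  \<comment> \<open>\<open>g\<close> averages \<open>f\<close> over the new coordinate and is passed
    to the induction hypothesis; \<open>h\<close> is the logarithmic moment over the old coordinates
    and is passed to \<open>gauss_transport\<close>.\<close>
  define g where "g = (\<lambda>v x. \<integral>y. f (x(i := y)) \<partial>gauss v)"
  define h where "h = (\<lambda>y. ln (\<integral>x. exp (f (x(i := y))) \<partial>gauss_PiM I (\<lambda>_. 0)))"
  have gm: "g v \<in> borel_measurable (PiM I (\<lambda>_. borel))" for v
  proof -
    have "g v \<in> borel_measurable (gauss_PiM I (\<lambda>_. 0))"
      unfolding g_def by measurable
    then show ?thesis by (simp add: measurable_cong_sets[OF sets_gauss_PiM refl])
  qed
  \<comment> \<open>The bound is required at every \<open>x\<close>, also outside the product space.
    If the section is not integrable its integral is 0 by convention, and the bound still holds as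
    \<open>0 \<le> C\<close>.\<close>
  have gb: "\<bar>g v x\<bar> \<le> C" for v x
  proof (cases "integrable (gauss v) (\<lambda>y. f (x(i := y)))")
    case True
    have "\<bar>g v x\<bar> \<le> (\<integral>y. \<bar>f (x(i := y))\<bar> \<partial>gauss v)" unfolding g_def by (rule integral_abs_bound)
    also have "\<dots> \<le> (\<integral>y. C \<partial>gauss v)" using True C by (intro integral_mono) auto
    finally show ?thesis using gauss.prob_space[of v] by simp
  next
    case False
    then show ?thesis using C0 by (simp add: g_def not_integrable_integral_eq)
  qed
  have hm: "h \<in> borel_measurable borel"
  proof -
    have "(\<lambda>(y, x). exp (f (x(i := y)))) \<in> borel_measurable (gauss 0 \<Otimes>\<^sub>M gauss_PiM I (\<lambda>_. 0))"
      using fm'[THEN measurable_pair_swap] by measurable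
    then have "h \<in> borel_measurable (gauss 0)" unfolding h_def by measurable
    then show ?thesis by (simp add: measurable_cong_sets[OF sets_gauss refl])
  qed
  have sec: "(\<lambda>x. f (x(i := y))) \<in> borel_measurable (gauss_PiM I u)" for y u
    using measurable_Pair1[OF fm'[of u 0], of y] by simp
  have E: "0 < (\<integral>x. exp (f (x(i := y))) \<partial>gauss_PiM I (\<lambda>_. 0))" for y
    by (rule gauss_PiM.ln_integral_exp_bounds(2)[OF sec C])
  have hb: "\<bar>h y\<bar> \<le> C" for y
    unfolding h_def by (rule gauss_PiM.ln_integral_exp_bounds(3)[OF sec C])
  have split: "(\<integral>x. f x \<partial>gauss_PiM (insert i I) u) = (\<integral>x. g (u i) x \<partial>gauss_PiM I u)" for u
  proof -
    interpret u: product_prob_space "\<lambda>i. gauss (u i)" by (rule product_prob_space_gauss)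
    show ?thesis unfolding g_def using C
      by (intro u.product_integral_insert gauss_PiM.integrable_const_bound[where B = C]) auto
  qed
  have exp_h: "(\<integral>y. exp (h y) \<partial>gauss 0) = (\<integral>x. exp (f x) \<partial>gauss_PiM (insert i I) (\<lambda>_. 0))"
  proof -
    interpret P: pair_prob_space "gauss_PiM I (\<lambda>_. 0)" "gauss 0" ..
    have "f x \<le> C" for x using C[of x] by linarith
    then have "integrable (gauss_PiM I (\<lambda>_. 0) \<Otimes>\<^sub>M gauss 0) (\<lambda>(x, y). exp (f (x(i := y))))"
      by (intro P.integrable_const_bound[where B = "exp C"]) auto
    then have "(\<integral>y. \<integral>x. exp (f (x(i := y))) \<partial>gauss_PiM I (\<lambda>_. 0) \<partial>gauss 0)
        = (\<integral>x. \<integral>y. exp (f (x(i := y))) \<partial>gauss 0 \<partial>gauss_PiM I (\<lambda>_. 0))"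
      by (rule P.Fubini_integral)
    also have "\<dots> = (\<integral>x. exp (f x) \<partial>gauss_PiM (insert i I) (\<lambda>_. 0))"
      using f C gauss_PiM.ln_integral_exp_bounds(1)[of f "insert i I" "\<lambda>_. 0" C]
      by (intro z.product_integral_insert[symmetric]) auto
    finally show ?thesis unfolding h_def using E by simp
  qed
  \<comment> \<open>By convexity, the logarithmic moment of \<open>g v\<close> is at most the
    \<open>gauss v\<close>-average of \<open>h\<close>; so the induction hypothesis yields a bound
    in terms of the single coordinate.\<close>
  have IH: "(\<Sum>A\<in>Pow I. exp ((\<integral>x. g v x \<partial>gauss_PiM I (\<lambda>i. s * sgn_in A i)) / \<kappa>)) / 2 ^ card I
      \<le> exp ((\<integral>y. h y \<partial>gauss v) / \<kappa>) * exp (card I * (s\<^sup>2)\<^sup>2 / \<kappa>)" for v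
  proof -
    have "ln (\<integral>x. exp (g v x) \<partial>gauss_PiM I (\<lambda>_. 0)) \<le> (\<integral>y. h y \<partial>gauss v)"
      unfolding g_def h_def
      by (rule ln_integral_exp_average[OF prob_space_gauss_PiM prob_space_gauss fm' C])
    then have "exp ((ln (\<integral>x. exp (g v x) \<partial>gauss_PiM I (\<lambda>_. 0)) + card I * (s\<^sup>2)\<^sup>2) / \<kappa>)
        \<le> exp (((\<integral>y. h y \<partial>gauss v) + card I * (s\<^sup>2)\<^sup>2) / \<kappa>)"
      using \<kappa> by (simp add: divide_right_mono)
    also have "\<dots> = exp ((\<integral>y. h y \<partial>gauss v) / \<kappa>) * exp (card I * (s\<^sup>2)\<^sup>2 / \<kappa>)"
      by (simp add: add_divide_distrib exp_add)
    finally show ?thesis using insert.IH[OF gm gb, of v] by linarith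
  qed
  let ?F = "\<lambda>A. exp ((\<integral>x. f x \<partial>gauss_PiM (insert i I) (\<lambda>i. s * sgn_in A i)) / \<kappa>)"
  have Fm: "?F A = exp ((\<integral>x. g (- s) x \<partial>gauss_PiM I (\<lambda>i. s * sgn_in A i)) / \<kappa>)" if "A \<in> Pow I" for A
  proof -
    have "sgn_in A i = - 1" using that insert.hyps by (auto simp: sgn_in_def)
    then show ?thesis by (simp add: split)
  qed
  have Fp: "?F (insert i A) = exp ((\<integral>x. g s x \<partial>gauss_PiM I (\<lambda>i. s * sgn_in A i)) / \<kappa>)" for A
  proof -
    have "gauss_PiM I (\<lambda>j. s * sgn_in (insert i A) j) = gauss_PiM I (\<lambda>j. s * sgn_in A j)"
      using insert.hyps by (intro PiM_cong refl) (auto simp: sgn_in_def)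
    moreover have "sgn_in (insert i A) i = 1" by (simp add: sgn_in_def)
    ultimately show ?thesis by (simp add: split)
  qed
  have "(\<Sum>A\<in>Pow (insert i I). ?F A) / 2 ^ card (insert i I)
      = ((\<Sum>A\<in>Pow I. exp ((\<integral>x. g s x \<partial>gauss_PiM I (\<lambda>i. s * sgn_in A i)) / \<kappa>)) / 2 ^ card I
        + (\<Sum>A\<in>Pow I. exp ((\<integral>x. g (- s) x \<partial>gauss_PiM I (\<lambda>i. s * sgn_in A i)) / \<kappa>)) / 2 ^ card I) / 2"
    by (simp add: sum_Pow_insert Fp Fm add_divide_distrib)
  also have "\<dots> \<le> (exp ((\<integral>y. h y \<partial>gauss s) / \<kappa>) * exp (card I * (s\<^sup>2)\<^sup>2 / \<kappa>)
        + exp ((\<integral>y. h y \<partial>gauss (- s)) / \<kappa>) * exp (card I * (s\<^sup>2)\<^sup>2 / \<kappa>)) / 2"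
    by (intro divide_right_mono add_mono IH) simp
  also have "\<dots> = (exp ((\<integral>y. h y \<partial>gauss s) / \<kappa>) + exp ((\<integral>y. h y \<partial>gauss (- s)) / \<kappa>)) / 2
        * exp (card I * (s\<^sup>2)\<^sup>2 / \<kappa>)"
    by (simp add: field_simps)
  also have "\<dots> \<le> exp ((ln (\<integral>y. exp (h y) \<partial>gauss 0) + (s\<^sup>2)\<^sup>2) / \<kappa>) * exp (card I * (s\<^sup>2)\<^sup>2 / \<kappa>)"
    unfolding \<kappa>_def by (intro mult_right_mono gauss_transport[OF hm hb s]) simp
  also have "\<dots> = exp ((ln (\<integral>x. exp (f x) \<partial>gauss_PiM (insert i I) (\<lambda>_. 0)) + card (insert i I) * (s\<^sup>2)\<^sup>2) / \<kappa>)"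
    by (simp add: exp_h add_divide_distrib algebra_simps flip: exp_add)
  finally show ?case .
qed

section \<open>One-bit tests\<close>

text \<open>A duality argument. Writing \<open>\<phi> A\<close> as the pairing of the centred test
  \<open>k\<close> with \<open>L A - 1\<close> gives \<open>S\<close> as the pairing of
  \<open>k\<close> with \<open>G\<close>. The norm of \<open>G\<close> is controlled by the Gram
  matrix of the \<open>L A - 1\<close>, whose largest eigenvalue is at most \<open>\<eta>\<close>
  after normalisation, and that of \<open>k\<close> by the variance of a bit.\<close>

lemma cube_variance:
  fixes K :: "('i \<Rightarrow> real) \<Rightarrow> real" and s :: real
  assumes I: "finite I" and K: "K \<in> borel_measurable (PiM I (\<lambda>_. borel))" "\<And>x. 0 \<le> K x" "\<And>x. K x \<le> 1"
    and s: "0 < s" "s\<^sup>2 \<le> 1 / 2"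
  defines "p \<equiv> \<lambda>A. \<integral>x. K x \<partial>gauss_PiM I (\<lambda>i. s * sgn_in A i)"
    and "p0 \<equiv> \<integral>x. K x \<partial>gauss_PiM I (\<lambda>_. 0)"
    and "\<eta> \<equiv> cosh (s\<^sup>2) ^ card I - 1 + cosh (s\<^sup>2) ^ card I * sinh (s\<^sup>2)"
  shows "(\<Sum>A\<in>Pow I. 1 / 2 ^ card I * (p A - p0)\<^sup>2) \<le> \<eta> * (p0 * (1 - p0))"
proof -
  let ?M = "gauss_PiM I (\<lambda>_. 0)"
  define w :: real where "w = 1 / 2 ^ card I"
  define L where "L = (\<lambda>A x. \<Prod>i\<in>I. tilt (s * sgn_in A i) (x i))"
  define \<phi> where "\<phi> = (\<lambda>A. p A - p0)"
  define k where "k = (\<lambda>x. K x - p0)"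
  define S where "S = (\<Sum>A\<in>Pow I. w * (\<phi> A)\<^sup>2)"
  define G where "G = (\<lambda>x. \<Sum>A\<in>Pow I. w * \<phi> A * (L A x - 1))"
  have w: "w > 0" by (simp add: w_def)
  have [measurable]: "K \<in> borel_measurable ?M" using K(1) by (simp add: measurable_cong_sets[OF sets_gauss_PiM refl])
  have Lm [measurable]: "L A \<in> borel_measurable ?M" for A
    using integrable_tilt_prod[OF I, of "\<lambda>i. s * sgn_in A i"] unfolding L_def by (rule borel_measurable_integrable)
  have L0: "0 \<le> L A x" for A x unfolding L_def by (intro prod_nonneg) auto
  have iL: "integrable ?M (L A)" "(\<integral>x. L A x \<partial>?M) = 1" for A
    unfolding L_def using integrable_tilt_prod[OF I] integral_tilt_prod[OF I] by auto
  have iLL: "integrable ?M (\<lambda>x. L A x * L B x)" for A B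
    unfolding L_def by (rule integrable_tilt_prod_mult[OF I])
  have LL: "(\<integral>x. L A x * L B x \<partial>?M) = (\<Prod>i\<in>I. exp (s\<^sup>2 * (sgn_in A i * sgn_in B i)))" for A B
    unfolding L_def integral_tilt_prod_mult[OF I] by (simp add: power2_eq_square mult_ac)
  have iK: "integrable ?M K" using K by (intro gauss_PiM.integrable_const_bound[where B = 1]) auto
  have p0: "0 \<le> p0" "p0 \<le> 1"
    using iK K gauss_PiM.prob_space[of I "\<lambda>_. 0"] integral_mono[of ?M K "\<lambda>_. 1"]
    unfolding p0_def by (auto intro: integral_nonneg_AE)
  have iK2: "integrable ?M (\<lambda>x. (K x)\<^sup>2)" 
    using K by (intro gauss_PiM.integrable_const_bound[where B = 1]) (auto simp: power_le_one)
  have ik2: "integrable ?M (\<lambda>x. (k x)\<^sup>2)" and k2: "(\<integral>x. (k x)\<^sup>2 \<partial>?M) \<le> p0 * (1 - p0)"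
  proof -
    have e: "(k x)\<^sup>2 = (K x)\<^sup>2 - 2 * p0 * K x + p0\<^sup>2" for x by (simp add: k_def power2_eq_square algebra_simps)
    show "integrable ?M (\<lambda>x. (k x)\<^sup>2)" unfolding e using iK iK2 by auto
    have "(\<integral>x. (k x)\<^sup>2 \<partial>?M) = (\<integral>x. (K x)\<^sup>2 \<partial>?M) - 2 * p0 * p0 + p0\<^sup>2"
      unfolding e using iK iK2 gauss_PiM.prob_space[of I "\<lambda>_. 0"] by (simp add: p0_def)
    \<comment> \<open>A value in the unit interval is at least its square, so randomisation only
      lowers the second moment.\<close>
    also have "(\<integral>x. (K x)\<^sup>2 \<partial>?M) \<le> p0"
      unfolding p0_def using iK iK2 K(2,3) by (intro integral_mono) (auto simp: power2_eq_square mult_left_le_one_le)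
    finally show "(\<integral>x. (k x)\<^sup>2 \<partial>?M) \<le> p0 * (1 - p0)" by (simp add: power2_eq_square algebra_simps)
  qed
  have kb: "\<bar>k x\<bar> \<le> 1" for x using K(2)[of x] K(3)[of x] p0 by (auto simp: k_def)
  have [measurable]: "k \<in> borel_measurable ?M" unfolding k_def by measurable
  have ik: "integrable ?M k" using kb by (intro gauss_PiM.integrable_const_bound[where B = 1]) auto
  have ikL: "integrable ?M (\<lambda>x. k x * L A x)" for A
  proof (rule Bochner_Integration.integrable_bound[OF iL(1)[of A]])
    show "AE x in ?M. norm (k x * L A x) \<le> norm (L A x)"
      using kb L0 by (auto simp: abs_mult mult_left_le_one_le)
  qed measurable
  have \<phi>: "\<phi> A = (\<integral>x. k x * (L A x - 1) \<partial>?M)" for A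
  proof -
    have LK: "integrable ?M (\<lambda>x. L A x * K x)"
    proof (rule Bochner_Integration.integrable_bound[OF iL(1)[of A]])
      show "AE x in ?M. norm (L A x * K x) \<le> norm (L A x)"
        using K(2,3) L0 by (auto simp: abs_mult mult_right_le_one_le)
    qed measurable
    have "p A = (\<integral>x. L A x * K x \<partial>?M)" unfolding p_def L_def by (rule integral_gauss_PiM[OF I K(1)])
    moreover have "(\<integral>x. k x * (L A x - 1) \<partial>?M) = (\<integral>x. L A x * K x - p0 * L A x - (K x - p0) \<partial>?M)"
      by (intro Bochner_Integration.integral_cong refl) (simp add: k_def algebra_simps)
    moreover have "\<dots> = (\<integral>x. L A x * K x \<partial>?M) - p0 * 1 - (p0 - p0)"
      using LK iL[of A] iK gauss_PiM.prob_space[of I "\<lambda>_. 0"] by (simp add: p0_def)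
    ultimately show ?thesis by (simp add: \<phi>_def)
  qed
  have ikL1: "integrable ?M (\<lambda>x. k x * (L A x - 1))" for A
    using ikL[of A] ik by (simp add: right_diff_distrib)
  have S: "S = (\<integral>x. k x * G x \<partial>?M)" and ikG: "integrable ?M (\<lambda>x. k x * G x)"
  proof -
    have kG: "k x * G x = (\<Sum>A\<in>Pow I. w * \<phi> A * (k x * (L A x - 1)))" for x
      by (simp add: G_def sum_distrib_left mult_ac)
    show "integrable ?M (\<lambda>x. k x * G x)" unfolding kG using ikL1 by auto
    have "(\<integral>x. k x * G x \<partial>?M) = (\<Sum>A\<in>Pow I. w * \<phi> A * \<phi> A)"
      unfolding kG using ikL1 by (simp add: \<phi>)
    then show "S = (\<integral>x. k x * G x \<partial>?M)" by (simp add: S_def power2_eq_square mult_ac)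
  qed
  have G2e: "(G x)\<^sup>2 = (\<Sum>A\<in>Pow I. \<Sum>B\<in>Pow I. w\<^sup>2 * (\<phi> A * \<phi> B) * (L A x * L B x - L A x - L B x + 1))" for x
    unfolding power2_eq_square G_def sum_product by (intro sum.cong refl) (simp add: algebra_simps)
  have iG2: "integrable ?M (\<lambda>x. (G x)\<^sup>2)" unfolding G2e using iLL iL by auto
  define c where "c = cosh (s\<^sup>2) ^ card I"
  have c1: "1 \<le> c" by (simp add: c_def cosh_real_ge_1)
  have sh: "0 < sinh (s\<^sup>2)" "sinh (s\<^sup>2) \<le> 1" using s sinh_le_two_times[of "s\<^sup>2"] by auto
  have \<eta>: "\<eta> = c - 1 + c * sinh (s\<^sup>2)" by (simp add: \<eta>_def c_def)
  have \<eta>0: "\<eta> > 0" using c1 sh mult_pos_pos[of c "sinh (s\<^sup>2)"] unfolding \<eta> by linarith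
  have "(\<integral>x. (G x)\<^sup>2 \<partial>?M)
      = (\<Sum>A\<in>Pow I. \<Sum>B\<in>Pow I. w\<^sup>2 * (\<phi> A * \<phi> B) * ((\<integral>x. L A x * L B x \<partial>?M) - 1 - 1 + 1))"
    unfolding G2e using iLL iL gauss_PiM.prob_space[of I "\<lambda>_. 0"] by simp
  also have "\<dots> = w\<^sup>2 * (cube_form (cosh (s\<^sup>2)) (sinh (s\<^sup>2)) I \<phi> \<phi> - (\<Sum>A\<in>Pow I. \<phi> A)\<^sup>2)"
  proof -
    have "(\<Sum>A\<in>Pow I. \<phi> A)\<^sup>2 = (\<Sum>A\<in>Pow I. \<Sum>B\<in>Pow I. \<phi> A * \<phi> B)"
      by (simp add: power2_eq_square sum_product)
    then show ?thesis
      unfolding cube_form_def LL exp_sgn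
      by (simp add: right_diff_distrib sum_subtractf sum_distrib_left mult.assoc)
  qed
  \<comment> \<open>Subtracting the squared sum lowers the eigenvalue of the constant function from
    \<open>c\<close> to \<open>c - 1\<close>; on its complement the form is bounded by
    \<open>c * sinh (s\<^sup>2)\<close>. The sum of the two is \<open>\<eta>\<close>.\<close>
  also have "\<dots> \<le> w\<^sup>2 * (\<eta> * (2 ^ card I * (\<Sum>A\<in>Pow I. (\<phi> A)\<^sup>2)))"
  proof (intro mult_left_mono)
    define X Y where "X = (\<Sum>A\<in>Pow I. \<phi> A)\<^sup>2" and "Y = 2 ^ card I * (\<Sum>A\<in>Pow I. (\<phi> A)\<^sup>2)"
    have XY: "0 \<le> X" "X \<le> Y"
      using sum_sq_le_card[of \<phi> "Pow I"] I by (auto simp: X_def Y_def card_Pow)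
    have "cube_form (cosh (s\<^sup>2)) (sinh (s\<^sup>2)) I \<phi> \<phi> \<le> c * X + c * sinh (s\<^sup>2) * (Y - X)"
      using cube_form_le[OF I, of "cosh (s\<^sup>2)" "sinh (s\<^sup>2)" \<phi>] sh by (simp add: c_def X_def Y_def cosh_real_ge_1)
    moreover have "(c - 1) * X \<le> (c - 1) * Y" using c1 XY by (intro mult_left_mono) auto
    moreover have "c * sinh (s\<^sup>2) * (Y - X) \<le> c * sinh (s\<^sup>2) * Y" using c1 sh XY by (intro mult_left_mono) auto
    ultimately show "cube_form (cosh (s\<^sup>2)) (sinh (s\<^sup>2)) I \<phi> \<phi> - (\<Sum>A\<in>Pow I. \<phi> A)\<^sup>2 \<le> \<eta> * Y"
      unfolding X_def[symmetric] by (simp add: \<eta> algebra_simps)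
  qed simp
  also have "\<dots> = \<eta> * S"
    by (simp add: S_def w_def power2_eq_square flip: sum_divide_distrib)
  finally have G2: "(\<integral>x. (G x)\<^sup>2 \<partial>?M) \<le> \<eta> * S" .
  \<comment> \<open>Weighted arithmetic-geometric mean inequality. With weight \<open>\<eta>\<close>
    the term in \<open>G\<close> is at most \<open>S\<close> and is absorbed on the left.\<close>
  have "2 * S = (\<integral>x. 2 * (k x * G x) \<partial>?M)" using S ikG by simp
  also have "\<dots> \<le> (\<integral>x. \<eta> * (k x)\<^sup>2 + (G x)\<^sup>2 / \<eta> \<partial>?M)"
  proof (intro integral_mono)
    fix x
    have "0 \<le> (\<eta> * k x - G x)\<^sup>2 / \<eta>" using \<eta>0 by simp
    also have "\<dots> = \<eta> * (k x)\<^sup>2 + (G x)\<^sup>2 / \<eta> - 2 * (k x * G x)"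
      using \<eta>0 by (simp add: power2_eq_square field_simps)
    finally show "2 * (k x * G x) \<le> \<eta> * (k x)\<^sup>2 + (G x)\<^sup>2 / \<eta>" by simp
  qed (use ik2 iG2 ikG in auto)
  also have "\<dots> = \<eta> * (\<integral>x. (k x)\<^sup>2 \<partial>?M) + (\<integral>x. (G x)\<^sup>2 \<partial>?M) / \<eta>" using ik2 iG2 by simp
  also have "\<dots> \<le> \<eta> * (p0 * (1 - p0)) + \<eta> * S / \<eta>"
    using k2 G2 \<eta>0 by (intro add_mono mult_left_mono divide_right_mono) auto
  finally have "S \<le> \<eta> * (p0 * (1 - p0))" using \<eta>0 by simp
  then show ?thesis by (simp add: S_def w_def \<phi>_def)
qed

text \<open>The \<open>transport\<close> property for a Gaussian machine with acceptance probability
  \<open>K\<close>: \<open>cube_transport\<close> bounds an exponential average over the cube, and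
  \<open>gibbs_variational\<close> converts it into a bound for an arbitrary density
  \<open>h\<close>.\<close>

lemma cube_transport_bit:
  fixes K :: "('i \<Rightarrow> real) \<Rightarrow> real" and s :: real
  assumes I: "finite I" and K: "K \<in> borel_measurable (PiM I (\<lambda>_. borel))" "\<And>x. 0 \<le> K x" "\<And>x. K x \<le> 1"
    and s: "0 < s" "s\<^sup>2 \<le> 1"
    and h: "\<And>A. A \<in> Pow I \<Longrightarrow> 0 \<le> h A" "(\<Sum>A\<in>Pow I. 1 / 2 ^ card I * h A) = 1"
  defines "q \<equiv> \<lambda>v b. if b then \<integral>x. K x \<partial>gauss_PiM I v else 1 - (\<integral>x. K x \<partial>gauss_PiM I v)"
  shows "(\<Sum>b\<in>UNIV. (\<Sum>A\<in>Pow I. 1 / 2 ^ card I * (h A * q (\<lambda>i. s * sgn_in A i) b)) * u b)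
    \<le> ln (\<Sum>b\<in>UNIV. q (\<lambda>_. 0) b * exp (u b))
      + 8 * s\<^sup>2 * (\<Sum>A\<in>Pow I. 1 / 2 ^ card I * (h A * ln (h A))) + card I * (s\<^sup>2)\<^sup>2"
proof -
  define w :: real where "w = 1 / 2 ^ card I"
  define \<kappa> where "\<kappa> = 8 * s\<^sup>2"
  have \<kappa>: "\<kappa> > 0" using s by (simp add: \<kappa>_def)
  have w: "w > 0" by (simp add: w_def)
  have cardPow: "real (card (Pow I)) = 2 ^ card I" using I by (simp add: card_Pow)
  \<comment> \<open>The conditional mean of \<open>u\<close> at the transmitted bit, given the
    observation.\<close>
  define f where "f = (\<lambda>x. (1 - K x) * u False + K x * u True)"
  have Km [measurable]: "K \<in> borel_measurable (gauss_PiM I v)" for v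
    using K(1) by (simp add: measurable_cong_sets[OF sets_gauss_PiM refl])
  have fm: "f \<in> borel_measurable (PiM I (\<lambda>_. borel))" unfolding f_def using K(1) by measurable
  have fm' [measurable]: "f \<in> borel_measurable (gauss_PiM I v)" for v unfolding f_def by measurable
  define C where "C = \<bar>u False\<bar> + \<bar>u True\<bar>"
  have fb: "\<bar>f x\<bar> \<le> C" for x
  proof -
    have "\<bar>f x\<bar> \<le> (1 - K x) * \<bar>u False\<bar> + K x * \<bar>u True\<bar>"
      unfolding f_def using K(2)[of x] K(3)[of x] by (intro order_trans[OF abs_triangle_ineq]) (simp add: abs_mult)
    also have "\<dots> \<le> 1 * \<bar>u False\<bar> + 1 * \<bar>u True\<bar>"
      using K(2)[of x] K(3)[of x] by (intro add_mono mult_right_mono) auto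
    finally show ?thesis by (simp add: C_def)
  qed
  have iK: "integrable (gauss_PiM I v) K" for v
    using K by (intro gauss_PiM.integrable_const_bound[where B = 1]) auto
  have intf: "(\<integral>x. f x \<partial>gauss_PiM I v) = (\<Sum>b\<in>UNIV. q v b * u b)" for v
    unfolding f_def using iK[of v] gauss_PiM.prob_space[of I v] by (simp add: sum_bool q_def)
  \<comment> \<open>Division by \<open>\<kappa>\<close> makes the entropy of \<open>h\<close> appear
    with factor \<open>\<kappa>\<close> once the variational inequality is multiplied back.\<close>
  define F where "F = (\<lambda>A. (\<integral>x. f x \<partial>gauss_PiM I (\<lambda>i. s * sgn_in A i)) / \<kappa>)"
  have "(\<Sum>A\<in>Pow I. w * (h A * F A)) \<le> (\<Sum>A\<in>Pow I. w * (h A * ln (h A))) + ln (\<Sum>A\<in>Pow I. w * exp (F A))"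
  proof (rule gibbs_variational)
    show "(\<Sum>A\<in>Pow I. w) = 1" by (simp add: w_def cardPow)
  qed (use I w h in \<open>auto simp: w_def\<close>)
  also have "ln (\<Sum>A\<in>Pow I. w * exp (F A))
      \<le> ln (exp ((ln (\<integral>x. exp (f x) \<partial>gauss_PiM I (\<lambda>_. 0)) + card I * (s\<^sup>2)\<^sup>2) / \<kappa>))"
  proof (subst ln_le_cancel_iff)
    show "0 < (\<Sum>A\<in>Pow I. w * exp (F A))" using w I by (intro sum_pos) auto
    show "(\<Sum>A\<in>Pow I. w * exp (F A)) \<le> exp ((ln (\<integral>x. exp (f x) \<partial>gauss_PiM I (\<lambda>_. 0)) + card I * (s\<^sup>2)\<^sup>2) / \<kappa>)"
      using cube_transport[OF I fm fb s] by (simp add: F_def \<kappa>_def w_def sum_divide_distrib)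
  qed simp
  finally have "(\<Sum>A\<in>Pow I. w * (h A * F A)) \<le> (\<Sum>A\<in>Pow I. w * (h A * ln (h A)))
      + (ln (\<integral>x. exp (f x) \<partial>gauss_PiM I (\<lambda>_. 0)) + card I * (s\<^sup>2)\<^sup>2) / \<kappa>" by simp
  then have "\<kappa> * (\<Sum>A\<in>Pow I. w * (h A * F A)) \<le> \<kappa> * ((\<Sum>A\<in>Pow I. w * (h A * ln (h A)))
      + (ln (\<integral>x. exp (f x) \<partial>gauss_PiM I (\<lambda>_. 0)) + card I * (s\<^sup>2)\<^sup>2) / \<kappa>)"
    using \<kappa> by (intro mult_left_mono) auto
  moreover have "\<kappa> * (X + Z / \<kappa>) = \<kappa> * X + Z" for X Z using \<kappa> by (simp add: distrib_left)
  ultimately have main: "\<kappa> * (\<Sum>A\<in>Pow I. w * (h A * F A)) \<le> \<kappa> * (\<Sum>A\<in>Pow I. w * (h A * ln (h A)))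
      + (ln (\<integral>x. exp (f x) \<partial>gauss_PiM I (\<lambda>_. 0)) + card I * (s\<^sup>2)\<^sup>2)"
    by metis
  have lhs: "\<kappa> * (\<Sum>A\<in>Pow I. w * (h A * F A))
      = (\<Sum>b\<in>UNIV. (\<Sum>A\<in>Pow I. w * (h A * q (\<lambda>i. s * sgn_in A i) b)) * u b)"
  proof -
    have F: "\<kappa> * F A = q (\<lambda>i. s * sgn_in A i) True * u True + q (\<lambda>i. s * sgn_in A i) False * u False" for A
      using \<kappa> by (simp add: F_def intf sum_bool)
    have "\<kappa> * (w * (h A * F A)) = w * h A * (\<kappa> * F A)" for A by simp
    then have "\<kappa> * (w * (h A * F A)) = w * (h A * q (\<lambda>i. s * sgn_in A i) True) * u True
        + w * (h A * q (\<lambda>i. s * sgn_in A i) False) * u False" for A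
      unfolding F by (simp add: distrib_left mult.assoc)
    then show ?thesis by (simp add: sum_distrib_left sum_bool sum.distrib sum_distrib_right)
  qed
  \<comment> \<open>Local randomisation is absorbed by convexity of \<open>exp\<close>:
    \<open>exp (f x)\<close> is at most the conditional mean of \<open>exp (u b)\<close>.\<close>
  have "ln (\<integral>x. exp (f x) \<partial>gauss_PiM I (\<lambda>_. 0)) \<le> ln (\<Sum>b\<in>UNIV. q (\<lambda>_. 0) b * exp (u b))"
  proof -
    have "(\<integral>x. exp (f x) \<partial>gauss_PiM I (\<lambda>_. 0))
        \<le> (\<integral>x. (1 - K x) * exp (u False) + K x * exp (u True) \<partial>gauss_PiM I (\<lambda>_. 0))"
    proof (intro integral_mono)
      show "exp (f x) \<le> (1 - K x) * exp (u False) + K x * exp (u True)" for x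
        using convex_onD[OF exp_convex, of "K x" "u False" "u True"] K(2)[of x] K(3)[of x] by (simp add: f_def)
    qed (use iK gauss_PiM.ln_integral_exp_bounds(1)[OF fm' fb] in auto)
    also have "\<dots> = (\<Sum>b\<in>UNIV. q (\<lambda>_. 0) b * exp (u b))"
      using iK gauss_PiM.prob_space[of I "\<lambda>_. 0"] by (simp add: sum_bool q_def)
    finally show ?thesis
      using gauss_PiM.ln_integral_exp_bounds(2)[OF fm' fb, of "\<lambda>_. 0"] by (subst ln_le_cancel_iff) auto
  qed
  then show ?thesis using main lhs by (simp add: w_def \<kappa>_def)
qed

text \<open>Applies \<open>mixture_le_product\<close> to a small multiple of the indicator of
  \<open>D\<close>. The total relative entropy is at most \<open>41 * c\<^sup>2\<close>; scaling the
  indicator by \<open>c\<close> costs another \<open>c\<^sup>2\<close>, and division by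
  \<open>c\<close> leaves \<open>42 * c\<close>.\<close>

lemma bit_tests_indistinguishable:
  fixes K :: "nat \<Rightarrow> ('i \<Rightarrow> real) \<Rightarrow> real" and s c :: real
  assumes I: "finite I" "I \<noteq> {}"
    and K: "\<And>j. j < m \<Longrightarrow> K j \<in> borel_measurable (PiM I (\<lambda>_. borel))" "\<And>j x. j < m \<Longrightarrow> 0 \<le> K j x" "\<And>j x. j < m \<Longrightarrow> K j x \<le> 1"
    and s: "0 < s" and m: "1 \<le> m" and c: "0 < c" "c \<le> 1 / 2"
    and c1: "m * s\<^sup>2 \<le> c" and c2: "m * (card I * (s\<^sup>2)\<^sup>2) \<le> c\<^sup>2" and D: "D \<subseteq> bit_vectors m"
  defines "q \<equiv> \<lambda>v j b. if b then \<integral>x. K j x \<partial>gauss_PiM I v else 1 - (\<integral>x. K j x \<partial>gauss_PiM I v)"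
  shows "(\<Sum>t\<in>D. \<Sum>A\<in>Pow I. 1 / 2 ^ card I * bits_prob (q (\<lambda>i. s * sgn_in A i)) m t)
    \<le> (\<Sum>t\<in>D. bits_prob (q (\<lambda>_. 0)) m t) + 42 * c"
proof -
  define t where "t = s\<^sup>2"
  define n where "n = real (card I)"
  define \<eta> where "\<eta> = cosh t ^ card I - 1 + cosh t ^ card I * sinh t"
  have t0: "0 < t" using s by (simp add: t_def)
  have "1 * t \<le> m * t" using m t0 by (intro mult_right_mono) auto
  then have tc: "t \<le> c" using c1 by (simp add: t_def)
  then have t1: "t \<le> 1 / 2" "t \<le> 1" using c by auto
  have n0: "0 \<le> n" by (simp add: n_def)
  then have nt: "0 \<le> n * t\<^sup>2" by simp
  have "1 * (n * t\<^sup>2) \<le> m * (n * t\<^sup>2)" using m nt by (intro mult_right_mono) auto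
  also have "\<dots> \<le> c\<^sup>2" using c2 by (simp add: n_def t_def)
  also have "c\<^sup>2 \<le> 1" using c by (simp add: power_le_one)
  finally have nt1: "n * t\<^sup>2 \<le> 1" by simp
  \<comment> \<open>The power of \<open>cosh t\<close> is at most \<open>exp x\<close> with
    \<open>x = n * t\<^sup>2 / 2\<close> in the unit interval, where
    \<open>exp x \<le> 1 + 2 * x\<close>.\<close>
  have cn: "cosh t ^ card I \<le> 1 + n * t\<^sup>2"
  proof -
    define x where "x = n * t\<^sup>2 / 2"
    have x: "0 \<le> x" "x \<le> 1" "2 * x \<le> 1" using nt nt1 by (auto simp: x_def)
    have "cosh t ^ card I \<le> exp (t\<^sup>2 / 2) ^ card I"
      by (intro power_mono cosh_le_exp_half_square) simp
    also have "\<dots> = exp x" by (simp add: x_def n_def flip: exp_of_nat_mult)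
    also have "\<dots> \<le> 1 + x + x\<^sup>2" using x exp_bound by blast
    also have "x\<^sup>2 \<le> x" using x by (simp add: power2_eq_square mult_left_le_one_le)
    finally show ?thesis by (simp add: x_def)
  qed
  have cn1: "1 \<le> cosh t ^ card I" by (simp add: cosh_real_ge_1)
  have sh: "0 \<le> sinh t" "sinh t \<le> 2 * t" using t0 t1 sinh_le_two_times[of t] by auto
  have \<eta>: "0 \<le> \<eta>" "\<eta> \<le> n * t\<^sup>2 + 4 * t"
  proof -
    show "0 \<le> \<eta>" using cn1 sh by (simp add: \<eta>_def)
    have "cosh t ^ card I * sinh t \<le> 2 * (2 * t)" using cn nt1 sh cn1 by (intro mult_mono) auto
    then show "\<eta> \<le> n * t\<^sup>2 + 4 * t" using cn by (simp add: \<eta>_def)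
  qed
  have q01: "0 \<le> (\<integral>x. K j x \<partial>gauss_PiM I v)" "(\<integral>x. K j x \<partial>gauss_PiM I v) \<le> 1" if "j < m" for j v
  proof -
    have "K j \<in> borel_measurable (gauss_PiM I v)"
      using K(1)[OF that] by (simp add: measurable_cong_sets[OF sets_gauss_PiM refl])
    then have "integrable (gauss_PiM I v) (K j)"
      using K(2,3)[OF that] by (intro gauss_PiM.integrable_const_bound[where B = 1]) auto
    then show "0 \<le> (\<integral>x. K j x \<partial>gauss_PiM I v)" "(\<integral>x. K j x \<partial>gauss_PiM I v) \<le> 1"
      using K(2,3)[OF that] gauss_PiM.prob_space[of I v] integral_mono[of "gauss_PiM I v" "K j" "\<lambda>_. 1"]
      by (auto intro: integral_nonneg_AE)
  qed
  interpret bit_machines "Pow I" "\<lambda>_. 1 / 2 ^ card I" "\<lambda>A. q (\<lambda>i. s * sgn_in A i)" "q (\<lambda>_. 0)" m \<eta> "8 * t" "n * t\<^sup>2"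
  proof
    fix j assume j: "j < m"
    show "(\<Sum>r\<in>Pow I. 1 / 2 ^ card I * (q (\<lambda>i. s * sgn_in r i) j True - q (\<lambda>_. 0) j True)\<^sup>2)
        \<le> \<eta> * (q (\<lambda>_. 0) j True * q (\<lambda>_. 0) j False)"
      using cube_variance[OF I(1) K[OF j], of s] s t1 by (simp add: q_def \<eta>_def t_def)
  next
    fix j and h :: "'i set \<Rightarrow> real" and u :: "bool \<Rightarrow> real"
    assume j: "j < m" and h: "\<And>r. r \<in> Pow I \<Longrightarrow> 0 \<le> h r" "(\<Sum>r\<in>Pow I. 1 / 2 ^ card I * h r) = 1"
    show "(\<Sum>b\<in>UNIV. (\<Sum>r\<in>Pow I. 1 / 2 ^ card I * (h r * q (\<lambda>i. s * sgn_in r i) j b)) * u b)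
        \<le> ln (\<Sum>b\<in>UNIV. q (\<lambda>_. 0) j b * exp (u b)) + 8 * t * (\<Sum>r\<in>Pow I. 1 / 2 ^ card I * (h r * ln (h r))) + n * t\<^sup>2"
      using cube_transport_bit[OF I(1) K[OF j] s _ h, of u] t1 unfolding q_def t_def n_def by simp
  qed (use I q01 t0 \<eta> in \<open>auto simp: q_def card_Pow\<close>)
  \<comment> \<open>The entropy budget from the chain rule. Bounding \<open>j\<close> by
    \<open>m\<close> and \<open>\<eta>\<close> by \<open>n * t\<^sup>2 + 4 * t\<close> splits it
    into parts of size 8, 32 and 1 times \<open>c\<^sup>2\<close>; the first uses
    \<open>m * t \<le> 1\<close>.\<close>
  define B where "B = (\<Sum>j<m. 8 * t * (real j * \<eta>) + n * t\<^sup>2)"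
  have "B \<le> (\<Sum>j<m. 8 * t * (real m * (n * t\<^sup>2 + 4 * t)) + n * t\<^sup>2)"
    unfolding B_def using \<eta> t0 n0 by (intro sum_mono add_mono mult_left_mono mult_mono) auto
  also have "\<dots> = 8 * (m * t) * (m * (n * t\<^sup>2)) + 32 * ((m * t) * (m * t)) + m * (n * t\<^sup>2)"
    by (simp add: algebra_simps power2_eq_square)
  also have "\<dots> \<le> 8 * 1 * c\<^sup>2 + 32 * (c * c) + c\<^sup>2"
    using c1 c2 c t0 nt by (intro add_mono mult_mono mult_left_mono) (auto simp: t_def n_def)
  finally have B: "B \<le> 41 * c\<^sup>2" by (simp add: power2_eq_square)
  \<comment> \<open>For this choice the left-hand side is \<open>c * P\<close> and the logarithm is
    at most \<open>Q * (exp c - 1)\<close>, hence at most \<open>c * Q + c\<^sup>2\<close>.\<close>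
  define g where "g = (\<lambda>t. if t \<in> D then c else 0)"
  have fD: "finite D" by (rule finite_subset[OF D finite_bit_vectors])
  define P where "P = (\<Sum>t\<in>D. mixture m t)"
  define Q where "Q = (\<Sum>t\<in>D. bits_prob (q (\<lambda>_. 0)) m t)"
  have qs: "(\<Sum>t\<in>bit_vectors m. bits_prob (q (\<lambda>_. 0)) m t) = 1"
    by (rule sum_bits_prob) (auto simp: q_def sum_bool)
  have qn: "0 \<le> bits_prob (q (\<lambda>_. 0)) m t" for t using q0_nonneg by (rule bits_prob_nonneg)
  have Q: "0 \<le> Q" "Q \<le> 1"
    unfolding Q_def using qn qs sum_mono2[OF finite_bit_vectors D, of "bits_prob (q (\<lambda>_. 0)) m"] by (auto intro: sum_nonneg)
  have "c * P = (\<Sum>t\<in>bit_vectors m. mixture m t * g t)"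
    unfolding P_def g_def sum_distrib_left using D
    by (intro sum.mono_neutral_cong_left) auto
  also have "\<dots> \<le> ln (\<Sum>t\<in>bit_vectors m. bits_prob (q (\<lambda>_. 0)) m t * exp (g t)) + B"
    unfolding B_def by (rule mixture_le_product) simp
  also have "(\<Sum>t\<in>bit_vectors m. bits_prob (q (\<lambda>_. 0)) m t * exp (g t)) = 1 + Q * (exp c - 1)"
  proof -
    have "(\<Sum>t\<in>bit_vectors m. bits_prob (q (\<lambda>_. 0)) m t * exp (g t))
        = (\<Sum>t\<in>bit_vectors m. bits_prob (q (\<lambda>_. 0)) m t + (if t \<in> D then bits_prob (q (\<lambda>_. 0)) m t * (exp c - 1) else 0))"
      by (intro sum.cong refl) (simp add: g_def algebra_simps)
    also have "\<dots> = 1 + (\<Sum>t\<in>bit_vectors m. (if t \<in> D then bits_prob (q (\<lambda>_. 0)) m t * (exp c - 1) else 0))"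
      by (simp add: sum.distrib qs)
    also have "(\<Sum>t\<in>bit_vectors m. (if t \<in> D then bits_prob (q (\<lambda>_. 0)) m t * (exp c - 1) else 0)) = Q * (exp c - 1)"
      unfolding Q_def sum_distrib_right using D by (intro sum.mono_neutral_cong_right) auto
    finally show ?thesis .
  qed
  also have "ln (1 + Q * (exp c - 1)) \<le> Q * (exp c - 1)"
    using Q c by (intro ln_add_one_self_le_self) simp
  also have "Q * (exp c - 1) \<le> Q * (c + c\<^sup>2)"
    using exp_bound[of c] c Q by (intro mult_left_mono) auto
  also have "\<dots> \<le> c * Q + c\<^sup>2" using Q by (simp add: distrib_left mult_left_le_one_le)
  finally have "c * P \<le> c * (Q + 42 * c)" using B by (simp add: algebra_simps power2_eq_square)
  then have "P \<le> Q + 42 * c" using c by simp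
  then show ?thesis by (simp add: P_def Q_def mixture_def)
qed

section \<open>The laws of data and bits\<close>

lemma emeasure_PiM_prob_space:
  assumes I: "finite I" and M: "\<And>i. i \<in> I \<Longrightarrow> prob_space (M i)" and A: "\<And>i. i \<in> I \<Longrightarrow> A i \<in> sets (M i)"
  shows "emeasure (PiM I M) (Pi\<^sub>E I A) = (\<Prod>i\<in>I. emeasure (M i) (A i))"
proof -
  \<comment> \<open>Outside \<open>I\<close> a point mass is filled in, since the product rule is
    stated for families that are probability spaces at every index; the product over
    \<open>I\<close> is unaffected.\<close>
  define N where "N = (\<lambda>i. if i \<in> I then M i else return (count_space UNIV) undefined)"
  interpret N: product_prob_space N
    by (intro product_prob_spaceI) (auto simp: N_def M intro!: prob_space_return)
  have "PiM I M = PiM I N" by (intro PiM_cong) (auto simp: N_def)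
  then show ?thesis using N.emeasure_PiM[OF I, of A] A by (simp add: N_def)
qed

lemma distr_PiM_componentwise:
  assumes I: "finite I" and M: "\<And>i. prob_space (M i)" and f [measurable]: "\<And>i. f i \<in> M i \<rightarrow>\<^sub>M N i"
  shows "distr (PiM I M) (PiM I N) (\<lambda>x. \<lambda>i\<in>I. f i (x i)) = PiM I (\<lambda>i. distr (M i) (N i) (f i))"
proof -
  have pd: "prob_space (distr (M i) (N i) (f i))" for i
    using f by (rule prob_space.prob_space_distr[OF M])
  interpret D: product_prob_space "\<lambda>i. distr (M i) (N i) (f i)"
    by (intro product_prob_spaceI pd)
  have fm [measurable]: "(\<lambda>x. \<lambda>i\<in>I. f i (x i)) \<in> PiM I M \<rightarrow>\<^sub>M PiM I N"
    by measurable
  show ?thesis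
  proof (rule D.PiM_eqI[OF I])
    show "sets (distr (PiM I M) (PiM I N) (\<lambda>x. \<lambda>i\<in>I. f i (x i))) = sets (PiM I (\<lambda>i. distr (M i) (N i) (f i)))"
      by (simp cong: sets_PiM_cong)
    fix A assume "\<And>i. i \<in> I \<Longrightarrow> A i \<in> sets (distr (M i) (N i) (f i))"
    then have A: "\<And>i. i \<in> I \<Longrightarrow> A i \<in> sets (N i)" by simp
    have "emeasure (distr (PiM I M) (PiM I N) (\<lambda>x. \<lambda>i\<in>I. f i (x i))) (Pi\<^sub>E I A)
        = emeasure (PiM I M) ((\<lambda>x. \<lambda>i\<in>I. f i (x i)) -` Pi\<^sub>E I A \<inter> space (PiM I M))"
      using I A by (intro emeasure_distr fm sets_PiM_I_finite)
    also have "(\<lambda>x. \<lambda>i\<in>I. f i (x i)) -` Pi\<^sub>E I A \<inter> space (PiM I M) = Pi\<^sub>E I (\<lambda>i. f i -` A i \<inter> space (M i))"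
      by (auto simp: space_PiM PiE_def Pi_def extensional_def)
    also have "emeasure (PiM I M) \<dots> = (\<Prod>i\<in>I. emeasure (M i) (f i -` A i \<inter> space (M i)))"
      using A by (intro emeasure_PiM_prob_space I M measurable_sets[OF f]) 
    also have "\<dots> = (\<Prod>i\<in>I. emeasure (distr (M i) (N i) (f i)) (A i))"
      using A by (intro prod.cong refl emeasure_distr[symmetric] f)
    finally show "emeasure (distr (PiM I M) (PiM I N) (\<lambda>x. \<lambda>i\<in>I. f i (x i))) (Pi\<^sub>E I A)
        = (\<Prod>i\<in>I. emeasure (distr (M i) (N i) (f i)) (A i))" .
  qed
qed

text \<open>Boxes form an intersection-stable generator, and on a box the product measure is a
  finite product of functions measurable in the parameter.\<close>

lemma measurable_PiM_kernel:
  assumes I: "finite I" and k: "\<And>i. i \<in> I \<Longrightarrow> k i \<in> M \<rightarrow>\<^sub>M prob_algebra (N i)"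
  shows "(\<lambda>x. PiM I (\<lambda>i. k i x)) \<in> M \<rightarrow>\<^sub>M prob_algebra (PiM I N)"
proof (intro measurable_prob_algebraI)
  have kx: "prob_space (k i x)" "sets (k i x) = sets (N i)" if "i \<in> I" "x \<in> space M" for i x
    using measurable_space[OF k[OF that(1)] that(2)] by (auto simp: space_prob_algebra)
  have kp: "prob_space (PiM I (\<lambda>i. k i x))" if "x \<in> space M" for x
    using kx that by (intro prob_space_PiM) auto
  show "x \<in> space M \<Longrightarrow> prob_space (PiM I (\<lambda>i. k i x))" for x by (rule kp)
  show "(\<lambda>x. PiM I (\<lambda>i. k i x)) \<in> M \<rightarrow>\<^sub>M subprob_algebra (PiM I N)"
  proof (rule measurable_subprob_algebra_generated[OF sets_PiM Int_stable_prod_algebra prod_algebra_sets_into_space])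
    show "subprob_space (PiM I (\<lambda>i. k i x))" if "x \<in> space M" for x
      using kp[OF that] by (rule prob_space_imp_subprob_space)
    show "sets (PiM I (\<lambda>i. k i x)) = sets (PiM I N)" if "x \<in> space M" for x
      using kx that by (intro sets_PiM_cong) auto
    have *: "(\<lambda>x. emeasure (PiM I (\<lambda>i. k i x)) (Pi\<^sub>E I A)) \<in> borel_measurable M"
      if A: "\<And>i. i \<in> I \<Longrightarrow> A i \<in> sets (N i)" for A
    proof -
      have "(\<lambda>x. \<Prod>i\<in>I. emeasure (k i x) (A i)) \<in> borel_measurable M"
        using A by (intro borel_measurable_prod_ennreal measurable_compose[OF measurable_prob_algebraD[OF k]]
            measurable_emeasure_subprob_algebra)
      moreover have "emeasure (PiM I (\<lambda>i. k i x)) (Pi\<^sub>E I A) = (\<Prod>i\<in>I. emeasure (k i x) (A i))" if "x \<in> space M" for x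
        using kx that A by (intro emeasure_PiM_prob_space I) auto
      ultimately show ?thesis by (simp cong: measurable_cong)
    qed
    show "(\<lambda>x. emeasure (PiM I (\<lambda>i. k i x)) A) \<in> borel_measurable M" if "A \<in> prod_algebra I N" for A
      using that * by (auto simp: prod_algebra_eq_finite[OF I])
    show "(\<lambda>x. emeasure (PiM I (\<lambda>i. k i x)) (\<Pi>\<^sub>E i\<in>I. space (N i))) \<in> borel_measurable M"
      by (rule *) auto
  qed
qed

lemma distr_gauss_shift: "distr (gauss 0) borel (\<lambda>x. v + x) = gauss v"
proof -
  have "distributed (gauss 0) lborel (\<lambda>x. x) (normal_density 0 1)"
    unfolding distributed_def
  proof (intro conjI)
    have "distr (gauss 0) lborel (\<lambda>x. x) = gauss 0" by (rule distr_id2) simp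
    then show "distr (gauss 0) lborel (\<lambda>x. x) = density lborel (\<lambda>x. ennreal (normal_density 0 1 x))"
      by (simp add: gauss_def)
  qed auto
  from gauss.normal_density_affine[OF this, of 1 v]
  have "distr (gauss 0) lborel (\<lambda>x. v + 1 * x) = density lborel (normal_density (v + 1 * 0) (\<bar>1\<bar> * 1))"
    by (intro distributed_distr_eq_density) auto
  moreover have "distr (gauss 0) lborel (\<lambda>x. v + x) = distr (gauss 0) borel (\<lambda>x. v + x)"
    by (intro distr_cong) auto
  ultimately show ?thesis by (simp add: gauss_def)
qed

definition observation_law :: "nat \<Rightarrow> nat \<Rightarrow> real ^ 'd \<Rightarrow> (real ^ 'd) measure" where
  "observation_law m n \<mu> = distr std_gaussian borel (\<lambda>z. \<mu> + sqrt (real m / real n) *\<^sub>R z)"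

lemma vec_measurable [measurable]:
  "(\<lambda>z. \<chi> i. z i) \<in> PiM UNIV (\<lambda>_. borel) \<rightarrow>\<^sub>M (borel :: (real ^ 'd) measure)"
  by (subst borel_measurable_euclidean_space) (auto simp: Basis_vec_def inner_axis)

lemma std_gaussian_eq:
  "(std_gaussian :: (real ^ 'd) measure) = distr (gauss_PiM UNIV (\<lambda>_. 0)) borel (\<lambda>z. \<chi> i. z i)"
  by (simp add: std_gaussian_def gauss_def)

lemma sets_std_gaussian [simp, measurable_cong]: "sets std_gaussian = sets borel"
  by (simp add: std_gaussian_eq)

lemma prob_space_std_gaussian: "prob_space (std_gaussian :: (real ^ 'd) measure)"
  unfolding std_gaussian_eq by (intro gauss_PiM.prob_space_distr) measurable

lemma prob_space_observation_law: "prob_space (observation_law m n \<mu>)"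
  unfolding observation_law_def by (intro prob_space.prob_space_distr prob_space_std_gaussian) measurable

lemma sets_observation_law [simp, measurable_cong]: "sets (observation_law m n \<mu>) = sets borel"
  by (simp add: observation_law_def)

lemma data_law_eq: "data_law m n \<mu> = PiM {..<m} (\<lambda>_. observation_law m n \<mu>)"
  unfolding data_law_def observation_law_def
  by (rule distr_PiM_componentwise) (auto intro: prob_space_std_gaussian)

text \<open>Measuring the signal in units of the noise level \<open>\<sigma>\<close> makes the
  observation a rescaled product of unit-variance Gaussians, so the results on
  \<open>gauss_PiM\<close> apply.\<close>

lemma observation_law_eq:
  fixes v :: "'d::finite \<Rightarrow> real" and m n :: nat
  defines "\<sigma> \<equiv> sqrt (real m / real n)"
  shows "observation_law m n (\<sigma> *\<^sub>R (\<chi> i. v i)) = distr (gauss_PiM UNIV v) borel (\<lambda>x. \<sigma> *\<^sub>R (\<chi> i. x i))"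
proof -
  have "gauss_PiM UNIV v = PiM UNIV (\<lambda>i. distr (gauss 0) borel (\<lambda>x. v i + x))"
    by (simp only: distr_gauss_shift)
  also have "\<dots> = distr (gauss_PiM UNIV (\<lambda>_. 0)) (PiM UNIV (\<lambda>_. borel)) (\<lambda>x. \<lambda>i\<in>UNIV. v i + x i)"
    by (rule distr_PiM_componentwise[symmetric]) (auto intro: prob_space_gauss)
  finally have "gauss_PiM UNIV v = \<dots>" .
  then have "distr (gauss_PiM UNIV v) borel (\<lambda>x. \<sigma> *\<^sub>R (\<chi> i. x i))
      = distr (gauss_PiM UNIV (\<lambda>_. 0)) borel (\<lambda>x. \<sigma> *\<^sub>R (\<chi> i. v i + x i))"
    by (simp add: distr_distr comp_def) (simp add: restrict_UNIV)
  also have "\<dots> = observation_law m n (\<sigma> *\<^sub>R (\<chi> i. v i))"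
    unfolding observation_law_def std_gaussian_eq \<sigma>_def[symmetric]
    by (subst distr_distr) (auto simp: comp_def scaleR_add_right[symmetric] vec_eq_iff intro!: distr_cong)
  finally show ?thesis by simp
qed

text \<open>The law of one bit with the coin frozen at \<open>u\<close>. Given the coin, the bits
  are independent because the observations are.\<close>

definition bit_prob :: "nat \<Rightarrow> nat \<Rightarrow> 'd dist_test \<Rightarrow> (nat \<Rightarrow> real) \<Rightarrow> real ^ 'd \<Rightarrow> nat \<Rightarrow> bool \<Rightarrow> real" where
  "bit_prob m n T u \<mu> j b = (\<integral>x. measure (kernel T j (x, u)) {b} \<partial>observation_law m n \<mu>)"

lemma sets_PiM_bits: "sets (PiM {..<m} (\<lambda>_. count_space (UNIV :: bool set))) = Pow (bit_vectors m)"
proof -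
  have "PiM {..<m} (\<lambda>_. count_space (UNIV :: bool set)) = count_space (bit_vectors m)"
    by (rule count_space_PiM_finite) auto
  then show ?thesis by simp
qed

lemma singleton_bit_vector: "t \<in> bit_vectors m \<Longrightarrow> {t} = Pi\<^sub>E {..<m} (\<lambda>j. {t j})"
  by (auto simp: PiE_eq_singleton PiE_iff extensional_def fun_eq_iff)

section \<open>The bits of a fixed test, conditionally on the coin\<close>

context
  fixes m n :: nat and T :: "('d::finite) dist_test"
  assumes T: "T \<in> dist_tests m"
begin

lemma prob_space_coin: "prob_space (coin T)"
  using T by (simp add: dist_tests_def)

lemma kernel_measurable: "j < m \<Longrightarrow> kernel T j \<in> borel \<Otimes>\<^sub>M coin T \<rightarrow>\<^sub>M prob_algebra (count_space UNIV)"
  using T by (simp add: dist_tests_def)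

lemma kernel_props:
  assumes "j < m" "u \<in> space (coin T)"
  shows "prob_space (kernel T j (x, u))" "sets (kernel T j (x, u)) = UNIV"
proof -
  have "(x, u) \<in> space (borel \<Otimes>\<^sub>M coin T)" using assms by (simp add: space_pair_measure)
  from measurable_space[OF kernel_measurable[OF assms(1)] this]
  show "prob_space (kernel T j (x, u))" "sets (kernel T j (x, u)) = UNIV" by (auto simp: space_prob_algebra)
qed

lemma kernel_prob_measurable:
  "j < m \<Longrightarrow> (\<lambda>p. measure (kernel T j p) {b}) \<in> borel_measurable (borel \<Otimes>\<^sub>M coin T)"
  by (rule measurable_compose[OF kernel_measurable measurable_measure_prob_algebra]) auto

lemma bits_kernel_measurable:
  "(\<lambda>(x, u). \<Pi>\<^sub>M j\<in>{..<m}. kernel T j (x j, u))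
    \<in> data_law m n \<mu> \<Otimes>\<^sub>M coin T \<rightarrow>\<^sub>M prob_algebra (PiM {..<m} (\<lambda>_. count_space UNIV))"
  unfolding split_def
proof (rule measurable_PiM_kernel)
  fix j assume "j \<in> {..<m}"
  then have j: "j < m" by simp
  have "(\<lambda>p. (fst p j, snd p)) \<in> data_law m n \<mu> \<Otimes>\<^sub>M coin T \<rightarrow>\<^sub>M borel \<Otimes>\<^sub>M coin T"
    using j unfolding data_law_eq
    by (intro measurable_Pair measurable_compose[OF measurable_fst measurable_component_singleton[of j]])
       (auto cong: measurable_cong_sets)
  then show "(\<lambda>p. kernel T j (fst p j, snd p)) \<in> data_law m n \<mu> \<Otimes>\<^sub>M coin T \<rightarrow>\<^sub>M prob_algebra (count_space UNIV)"
    by (rule measurable_compose[OF _ kernel_measurable[OF j]])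
qed simp

lemma prob_space_data_law: "prob_space (data_law m n \<mu>)"
  unfolding data_law_eq by (intro prob_space_PiM prob_space_observation_law)

lemma prob_space_joint: "prob_space (data_law m n \<mu> \<Otimes>\<^sub>M coin T)"
proof -
  interpret D: prob_space "data_law m n \<mu>" by (rule prob_space_data_law)
  interpret C: prob_space "coin T" by (rule prob_space_coin)
  interpret P: pair_prob_space "data_law m n \<mu>" "coin T" ..
  show ?thesis by (rule P.prob_space_axioms)
qed

lemma measure_PiM_kernel:
  assumes u: "u \<in> space (coin T)" and S: "S \<subseteq> bit_vectors m"
  shows "measure (\<Pi>\<^sub>M j\<in>{..<m}. kernel T j (x j, u)) S = (\<Sum>t\<in>S. bits_prob (\<lambda>j b. measure (kernel T j (x j, u)) {b}) m t)"
proof -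
  let ?P = "\<Pi>\<^sub>M j\<in>{..<m}. kernel T j (x j, u)"
  interpret P: prob_space ?P using kernel_props[OF _ u] by (intro prob_space_PiM) auto
  have "sets ?P = sets (PiM {..<m} (\<lambda>_. count_space (UNIV :: bool set)))"
    using kernel_props(2)[OF _ u] by (intro sets_PiM_cong) auto
  then have sets: "sets ?P = Pow (bit_vectors m)" by (simp add: sets_PiM_bits)
  have "measure ?P S = (\<Sum>t\<in>S. measure ?P {t})"
    using finite_subset[OF S finite_bit_vectors] sets S by (intro P.finite_measure_eq_sum_singleton) auto
  also have "\<dots> = (\<Sum>t\<in>S. bits_prob (\<lambda>j b. measure (kernel T j (x j, u)) {b}) m t)"
  proof (intro sum.cong refl)
    fix t assume "t \<in> S"
    then have t: "t \<in> bit_vectors m" using S by auto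
    have "emeasure ?P {t} = (\<Prod>j<m. emeasure (kernel T j (x j, u)) {t j})"
      unfolding singleton_bit_vector[OF t] using kernel_props[OF _ u] by (intro emeasure_PiM_prob_space) auto
    also have "\<dots> = (\<Prod>j<m. ennreal (measure (kernel T j (x j, u)) {t j}))"
      using kernel_props(1)[OF _ u]
      by (intro prod.cong refl) (simp add: finite_measure.emeasure_eq_measure prob_space.finite_measure)
    also have "\<dots> = ennreal (bits_prob (\<lambda>j b. measure (kernel T j (x j, u)) {b}) m t)"
      by (simp add: bits_prob_def prod_ennreal)
    finally show "measure ?P {t} = bits_prob (\<lambda>j b. measure (kernel T j (x j, u)) {b}) m t"
      by (simp add: measure_def bits_prob_nonneg)
  qed
  finally show ?thesis .
qed

lemma bit_prob_integrable:
  assumes "j < m" "u \<in> space (coin T)"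
  shows "integrable (observation_law m n \<mu>) (\<lambda>x. measure (kernel T j (x, u)) {b})"
proof -
  interpret prob_space "observation_law m n \<mu>" by (rule prob_space_observation_law)
  have "(\<lambda>x. measure (kernel T j (x, u)) {b}) \<in> borel_measurable borel"
    using measurable_Pair1[OF kernel_prob_measurable[OF assms(1)] assms(2)] by simp
  then have "(\<lambda>x. measure (kernel T j (x, u)) {b}) \<in> borel_measurable (observation_law m n \<mu>)"
    by (simp cong: measurable_cong_sets)
  then show ?thesis
    using kernel_props(1)[OF assms] by (intro integrable_const_bound[where B = 1]) (auto intro: prob_space.prob_le_1)
qed

text \<open>Disintegration over the coin: for each coin value the law of the bits is a product,
  because both the data law and the kernels factor over the machines.\<close>

lemma measure_bits_law:
  assumes S: "S \<subseteq> bit_vectors m"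
  shows "integrable (coin T) (\<lambda>u. \<Sum>t\<in>S. bits_prob (bit_prob m n T u \<mu>) m t)"
    and "measure (bits_law m n \<mu> T) S = (\<integral>u. (\<Sum>t\<in>S. bits_prob (bit_prob m n T u \<mu>) m t) \<partial>coin T)"
proof -
  interpret D: prob_space "data_law m n \<mu>" by (rule prob_space_data_law)
  interpret C: prob_space "coin T" by (rule prob_space_coin)
  interpret P: pair_prob_space "data_law m n \<mu>" "coin T" ..
  interpret O: product_prob_space "\<lambda>_ :: nat. observation_law m n \<mu>"
    by (intro product_prob_spaceI prob_space_observation_law)
  let ?M = "data_law m n \<mu> \<Otimes>\<^sub>M coin T"
  let ?N = "PiM {..<m} (\<lambda>_. count_space (UNIV :: bool set))"
  define k where "k = (\<lambda>(x :: nat \<Rightarrow> real ^ 'd, u). \<Pi>\<^sub>M j\<in>{..<m}. kernel T j (x j, u))"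
  have km: "k \<in> ?M \<rightarrow>\<^sub>M prob_algebra ?N" unfolding k_def by (rule bits_kernel_measurable)
  have SN: "S \<in> sets ?N" using S by (simp add: sets_PiM_bits)
  have kp: "prob_space (k p)" if "p \<in> space ?M" for p
    using measurable_space[OF km that] by (simp add: space_prob_algebra)
  have fm: "(\<lambda>p. measure (k p) S) \<in> borel_measurable ?M"
    by (rule measurable_compose[OF km measurable_measure_prob_algebra[OF SN]])
  have fi: "integrable ?M (\<lambda>p. measure (k p) S)"
    using kp by (intro P.integrable_const_bound[where B = 1] fm) (auto intro!: AE_I2 prob_space.prob_le_1)
  have "emeasure (bits_law m n \<mu> T) S = (\<integral>\<^sup>+p. emeasure (k p) S \<partial>?M)"
    unfolding bits_law_def k_def[symmetric]
    using P.not_empty km SN by (intro emeasure_bind measurable_prob_algebraD) auto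
  also have "\<dots> = (\<integral>\<^sup>+p. ennreal (measure (k p) S) \<partial>?M)"
    using kp by (intro nn_integral_cong) (simp add: finite_measure.emeasure_eq_measure prob_space.finite_measure)
  also have "\<dots> = ennreal (\<integral>p. measure (k p) S \<partial>?M)"
    using fi by (intro nn_integral_eq_integral) auto
  finally have "measure (bits_law m n \<mu> T) S = (\<integral>p. measure (k p) S \<partial>?M)"
    by (simp add: measure_def integral_nonneg_AE)
  \<comment> \<open>Fubini with the coin outermost, so that the product structure of the data can be
    used inside at a fixed \<open>u\<close>.\<close>
  also have "\<dots> = (\<integral>u. \<integral>x. measure (k (x, u)) S \<partial>data_law m n \<mu> \<partial>coin T)"
    using P.integral_snd[of "\<lambda>x u. measure (k (x, u)) S"] fi by (simp add: split_def)
  finally have 1: "measure (bits_law m n \<mu> T) S = (\<integral>u. \<integral>x. measure (k (x, u)) S \<partial>data_law m n \<mu> \<partial>coin T)" .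
  have 2: "(\<integral>x. measure (k (x, u)) S \<partial>data_law m n \<mu>) = (\<Sum>t\<in>S. bits_prob (bit_prob m n T u \<mu>) m t)"
    if u: "u \<in> space (coin T)" for u
  proof -
    let ?b = "\<lambda>t j x. measure (kernel T j (x, u)) {t j}"
    have i: "integrable (data_law m n \<mu>) (\<lambda>x. \<Prod>j<m. ?b t j (x j))" for t
      unfolding data_law_eq using bit_prob_integrable[OF _ u] by (intro O.product_integrable_prod) auto
    have "(\<integral>x. measure (k (x, u)) S \<partial>data_law m n \<mu>) = (\<integral>x. (\<Sum>t\<in>S. \<Prod>j<m. ?b t j (x j)) \<partial>data_law m n \<mu>)"
      unfolding k_def using measure_PiM_kernel[OF u S] by (simp add: bits_prob_def)
    also have "\<dots> = (\<Sum>t\<in>S. \<integral>x. (\<Prod>j<m. ?b t j (x j)) \<partial>data_law m n \<mu>)"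
      using i by (intro Bochner_Integration.integral_sum)
    also have "\<dots> = (\<Sum>t\<in>S. \<Prod>j<m. bit_prob m n T u \<mu> j (t j))"
      unfolding data_law_eq bit_prob_def using bit_prob_integrable[OF _ u]
      by (intro sum.cong refl O.product_integral_prod) auto
    finally show ?thesis by (simp add: bits_prob_def)
  qed
  show "measure (bits_law m n \<mu> T) S = (\<integral>u. (\<Sum>t\<in>S. bits_prob (bit_prob m n T u \<mu>) m t) \<partial>coin T)"
    unfolding 1 by (intro Bochner_Integration.integral_cong refl 2)
  have "integrable (coin T) (\<lambda>u. \<integral>x. measure (k (x, u)) S \<partial>data_law m n \<mu>)"
    using P.integrable_snd[of "\<lambda>x u. measure (k (x, u)) S"] fi by (simp add: split_def)
  then show "integrable (coin T) (\<lambda>u. \<Sum>t\<in>S. bits_prob (bit_prob m n T u \<mu>) m t)"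
    by (simp add: 2 cong: Bochner_Integration.integrable_cong)
qed

lemma bits_law_prob:
  shows "space (bits_law m n \<mu> T) = bit_vectors m" and "prob_space (bits_law m n \<mu> T)"
proof -
  interpret P: prob_space "data_law m n \<mu> \<Otimes>\<^sub>M coin T" by (rule prob_space_joint)
  let ?N = "PiM {..<m} (\<lambda>_. count_space (UNIV :: bool set))"
  have A: "data_law m n \<mu> \<Otimes>\<^sub>M coin T \<in> space (prob_algebra (data_law m n \<mu> \<Otimes>\<^sub>M coin T))"
    by (simp add: space_prob_algebra P.prob_space_axioms)
  have "sets (bits_law m n \<mu> T) = sets ?N"
    unfolding bits_law_def by (rule sets_bind'[OF A bits_kernel_measurable])
  from sets_eq_imp_space_eq[OF this] show "space (bits_law m n \<mu> T) = bit_vectors m"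
    by (simp add: space_PiM)
  show "prob_space (bits_law m n \<mu> T)"
    unfolding bits_law_def by (rule prob_space_bind'[OF A bits_kernel_measurable])
qed

text \<open>Rewrites the kernel as a function \<open>K\<close> of the standardised observation, the
  form in which \<open>bit_tests_indistinguishable\<close> describes a machine.\<close>

lemma bit_prob_eq:
  fixes v :: "'d \<Rightarrow> real"
  assumes j: "j < m" and u: "u \<in> space (coin T)"
  defines "\<sigma> \<equiv> sqrt (real m / real n)"
  defines "K \<equiv> \<lambda>x. measure (kernel T j (\<sigma> *\<^sub>R (\<chi> i. x i), u)) {True}"
  shows "K \<in> borel_measurable (PiM UNIV (\<lambda>_. borel))"
    and "bit_prob m n T u (\<sigma> *\<^sub>R (\<chi> i. v i)) j b
      = (if b then \<integral>x. K x \<partial>gauss_PiM UNIV v else 1 - (\<integral>x. K x \<partial>gauss_PiM UNIV v))"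
proof -
  have bm: "(\<lambda>x. measure (kernel T j (x, u)) {True}) \<in> borel_measurable borel"
    using measurable_Pair1[OF kernel_prob_measurable[OF j] u] by simp
  show "K \<in> borel_measurable (PiM UNIV (\<lambda>_. borel))"
    unfolding K_def by (rule measurable_compose[OF _ bm]) measurable
  have 1: "bit_prob m n T u (\<sigma> *\<^sub>R (\<chi> i. v i)) j True = (\<integral>x. K x \<partial>gauss_PiM UNIV v)"
    unfolding bit_prob_def \<sigma>_def observation_law_eq K_def
    by (subst integral_distr) (auto intro: bm)
  interpret O: prob_space "observation_law m n (\<sigma> *\<^sub>R (\<chi> i. v i))" by (rule prob_space_observation_law)
  have UNIV_diff_True: "UNIV - {True} = {False}" by auto
  have f: "measure (kernel T j (x, u)) {False} = 1 - measure (kernel T j (x, u)) {True}" for x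
  proof -
    interpret k: prob_space "kernel T j (x, u)" by (rule kernel_props(1)[OF j u])
    have "space (kernel T j (x, u)) = UNIV"
      using kernel_props(2)[OF j u, of x] by (metis UNIV_I sets.sets_into_space top.extremum_uniqueI)
    then show ?thesis
      using k.prob_compl[of "{True}"] kernel_props(2)[OF j u, of x] UNIV_diff_True by simp
  qed
  have "bit_prob m n T u (\<sigma> *\<^sub>R (\<chi> i. v i)) j False = 1 - bit_prob m n T u (\<sigma> *\<^sub>R (\<chi> i. v i)) j True"
    unfolding bit_prob_def f using bit_prob_integrable[OF j u] O.prob_space by simp
  then show "bit_prob m n T u (\<sigma> *\<^sub>R (\<chi> i. v i)) j b
      = (if b then \<integral>x. K x \<partial>gauss_PiM UNIV v else 1 - (\<integral>x. K x \<partial>gauss_PiM UNIV v))"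
    using 1 by simp
qed

end

section \<open>The lower bound\<close>

text \<open>Bounding an infimum of reals from below requires a nonempty set. The witness has a coin
  of dimension 0 and constant bits.\<close>

lemma dist_tests_nonempty: "(dist_tests m :: ('d::finite) dist_test set) \<noteq> {}"
proof -
  define T :: "'d dist_test" where
    "T = \<lparr>coin = PiM {..<0} (\<lambda>_. borel), kernel = (\<lambda>_ _. return (count_space UNIV) True), decision = (\<lambda>_. True)\<rparr>"
  have "return (count_space UNIV) True \<in> space (prob_algebra (count_space (UNIV :: bool set)))"
    by (simp add: space_prob_algebra prob_space_return)
  moreover have "prob_space (PiM {..<0::nat} (\<lambda>_. borel :: real measure))"
    by (intro prob_space_PiM) auto
  ultimately have "T \<in> dist_tests m"
    by (auto simp: dist_tests_def T_def intro!: exI[of _ "0::nat"])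
  then show ?thesis by blast
qed

text \<open>The supremum of the type II error is at least its average over the sign vectors. As this
  prior does not depend on the coin, the averages can be exchanged and the bound proved for each
  coin value separately.\<close>

lemma risk_ge:
  fixes T :: "('d::finite) dist_test" and c :: real
  assumes T: "T \<in> dist_tests m" and m: "m \<ge> 1" and n: "n \<ge> 1" and \<rho>: "0 < \<rho>" and c: "0 < c" "c \<le> 1 / 2"
    and c1: "n * \<rho>\<^sup>2 \<le> c * CARD('d)" and c2: "(n * \<rho>\<^sup>2)\<^sup>2 \<le> c\<^sup>2 * (m * CARD('d))"
  shows "1 - 42 * c \<le> risk m n \<rho> T"
proof -
  define d where "d = real CARD('d)"
  define \<sigma> where "\<sigma> = sqrt (real m / real n)"
  \<comment> \<open>Each coordinate of \<open>\<mu> A\<close> is \<open>\<rho> / sqrt d\<close> up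
    to sign; \<open>s\<close> is this size in units of \<open>\<sigma>\<close>.\<close>
  define s where "s = \<rho> / (\<sigma> * sqrt d)"
  define w :: real where "w = 1 / 2 ^ CARD('d)"
  define \<mu> :: "'d set \<Rightarrow> real ^ 'd" where "\<mu> = (\<lambda>A. \<sigma> *\<^sub>R (\<chi> i. s * sgn_in A i))"
  define D where "D = {t \<in> bit_vectors m. decision T t}"
  define N where "N = {t \<in> bit_vectors m. \<not> decision T t}"
  define P where "P = (\<lambda>u v t. bits_prob (bit_prob m n T u v) m t)"
  interpret C: prob_space "coin T" by (rule prob_space_coin[OF T])
  have d: "d > 0" by (simp add: d_def)
  have \<sigma>: "\<sigma> > 0" "\<sigma>\<^sup>2 = m / n" using m n by (auto simp: \<sigma>_def)
  have s: "s > 0" "s\<^sup>2 = n * \<rho>\<^sup>2 / (m * d)" using \<rho> \<sigma> d by (auto simp: s_def power_divide power_mult_distrib)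
  have norm_\<mu>: "norm (\<mu> A) = \<rho>" for A
  proof -
    have "(sgn_in A i)\<^sup>2 = 1" for i by (simp add: sgn_in_def)
    then have "norm (\<chi> i. s * sgn_in A i) = sqrt (d * s\<^sup>2)"
      by (simp add: norm_vec_def L2_set_def power_mult_distrib d_def)
    also have "\<dots> = sqrt d * s"
      using abs_of_pos[OF s(1)] by (simp only: real_sqrt_mult real_sqrt_abs)
    finally show ?thesis using \<sigma> d by (simp add: \<mu>_def s_def)
  qed
  have subs: "D \<subseteq> bit_vectors m" "N \<subseteq> bit_vectors m" by (auto simp: D_def N_def)
  have pD: "\<P>(t in bits_law m n v T. decision T t) = measure (bits_law m n v T) D" for v
    by (simp add: bits_law_prob(1)[OF T] D_def)
  have pN: "\<P>(t in bits_law m n v T. \<not> decision T t) = measure (bits_law m n v T) N" for v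
    by (simp add: bits_law_prob(1)[OF T] N_def)
  have sup: "measure (bits_law m n (\<mu> A) T) N \<le> (SUP v\<in>{v. norm v \<ge> \<rho>}. measure (bits_law m n v T) N)" for A
  proof (rule cSUP_upper)
    show "bdd_above ((\<lambda>v. measure (bits_law m n v T) N) ` {v. \<rho> \<le> norm v})"
      using prob_space.prob_le_1[OF bits_law_prob(2)[OF T]] by (intro bdd_aboveI2)
  qed (simp add: norm_\<mu>)
  have w: "(\<Sum>A\<in>(UNIV :: 'd set set). w) = 1"
    by (simp add: w_def card_UNIV_set)
  have "(\<Sum>A\<in>(UNIV :: 'd set set). w * measure (bits_law m n (\<mu> A) T) N)
      \<le> (\<Sum>A\<in>(UNIV :: 'd set set). w * (SUP v\<in>{v. norm v \<ge> \<rho>}. measure (bits_law m n v T) N))"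
    by (intro sum_mono mult_left_mono sup) (simp add: w_def)
  also have "\<dots> = (SUP v\<in>{v. norm v \<ge> \<rho>}. measure (bits_law m n v T) N)"
    using w by (simp flip: sum_distrib_right)
  finally have avg: "measure (bits_law m n 0 T) D + (\<Sum>A\<in>UNIV. w * measure (bits_law m n (\<mu> A) T) N) \<le> risk m n \<rho> T"
    by (simp add: risk_def pD pN)
  have int: "integrable (coin T) (\<lambda>u. \<Sum>t\<in>D. P u 0 t)" "integrable (coin T) (\<lambda>u. \<Sum>t\<in>N. P u (\<mu> A) t)" for A
    unfolding P_def using measure_bits_law(1)[OF T] subs by auto
  have "measure (bits_law m n 0 T) D + (\<Sum>A\<in>UNIV. w * measure (bits_law m n (\<mu> A) T) N)
      = (\<integral>u. (\<Sum>t\<in>D. P u 0 t) + (\<Sum>A\<in>UNIV. w * (\<Sum>t\<in>N. P u (\<mu> A) t)) \<partial>coin T)"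
    using int by (simp add: measure_bits_law(2)[OF T] subs P_def)
  also have "\<dots> \<ge> (\<integral>u. 1 - 42 * c \<partial>coin T)"
  proof (intro integral_mono)
    show "integrable (coin T) (\<lambda>u. (\<Sum>t\<in>D. P u 0 t) + (\<Sum>A\<in>UNIV. w * (\<Sum>t\<in>N. P u (\<mu> A) t)))"
      using int by auto
    \<comment> \<open>With the coin fixed, the test consists of \<open>m\<close> independent
      randomised bits and a deterministic rejection set \<open>D\<close>.\<close>
    fix u assume u: "u \<in> space (coin T)"
    define K where "K = (\<lambda>j x. measure (kernel T j (\<sigma> *\<^sub>R (\<chi> i. x i), u)) {True})"
    define q where "q = (\<lambda>v j b. if b then \<integral>x. K j x \<partial>gauss_PiM UNIV v else 1 - (\<integral>x. K j x \<partial>gauss_PiM UNIV v))"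
    have bq: "bit_prob m n T u (\<sigma> *\<^sub>R (\<chi> i. v i)) j b = q v j b" if "j < m" for v j b
      unfolding q_def K_def \<sigma>_def by (rule bit_prob_eq(2)[OF T that u])
    have Pq: "P u (\<sigma> *\<^sub>R (\<chi> i. v i)) t = bits_prob (q v) m t" for v t
      unfolding P_def bits_prob_def using bq by (intro prod.cong) auto
    have "(0 :: real ^ 'd) = \<sigma> *\<^sub>R (\<chi> i. 0)" by (simp add: vec_eq_iff)
    then have P0: "P u 0 t = bits_prob (q (\<lambda>_. 0)) m t" for t using Pq[of "\<lambda>_. 0" t] by metis
    have P\<mu>: "P u (\<mu> A) t = bits_prob (q (\<lambda>i. s * sgn_in A i)) m t" for A t
      unfolding \<mu>_def by (rule Pq)
    have "(\<Sum>t\<in>D. \<Sum>A\<in>Pow UNIV. 1 / 2 ^ card (UNIV :: 'd set) * bits_prob (q (\<lambda>i. s * sgn_in A i)) m t)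
        \<le> (\<Sum>t\<in>D. bits_prob (q (\<lambda>_. 0)) m t) + 42 * c"
      unfolding q_def
    proof (rule bit_tests_indistinguishable)
      show "K j \<in> borel_measurable (PiM UNIV (\<lambda>_. borel))" if "j < m" for j
        unfolding K_def \<sigma>_def by (rule bit_prob_eq(1)[OF T that u])
      show "K j x \<le> 1" if "j < m" for j x
        unfolding K_def by (rule prob_space.prob_le_1[OF kernel_props(1)[OF T that u]])
      have "m * s\<^sup>2 = n * \<rho>\<^sup>2 / d" using s m by simp
      also have "\<dots> \<le> c" using c1 d by (simp add: d_def pos_divide_le_eq)
      finally show "m * s\<^sup>2 \<le> c" .
      have "m * (CARD('d) * (s\<^sup>2)\<^sup>2) = (n * \<rho>\<^sup>2)\<^sup>2 / (m * d)"
        unfolding s(2) using m d by (simp add: d_def power2_eq_square)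
      also have "\<dots> \<le> c\<^sup>2" using c2 d m by (simp add: d_def pos_divide_le_eq)
      finally show "m * (CARD('d) * (s\<^sup>2)\<^sup>2) \<le> c\<^sup>2" .
    qed (use s m c subs in \<open>auto simp: K_def\<close>)
    then have "(\<Sum>A\<in>UNIV. w * (\<Sum>t\<in>D. P u (\<mu> A) t)) \<le> (\<Sum>t\<in>D. P u 0 t) + 42 * c"
      unfolding P0 P\<mu> w_def sum_distrib_left by (subst sum.swap) simp
    \<comment> \<open>\<open>D\<close> and \<open>N\<close> partition the bit vectors, so a nearly
      unchanged rejection probability forces the two errors to add up to almost 1.\<close>
    moreover have "(\<Sum>t\<in>D. P u (\<mu> A) t) + (\<Sum>t\<in>N. P u (\<mu> A) t) = 1" for A
    proof -
      have "(\<Sum>t\<in>D. P u (\<mu> A) t) + (\<Sum>t\<in>N. P u (\<mu> A) t) = (\<Sum>t\<in>D \<union> N. P u (\<mu> A) t)"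
        using subs by (intro sum.union_disjoint[symmetric]) (auto simp: D_def N_def intro: finite_subset[OF _ finite_bit_vectors])
      also have "D \<union> N = bit_vectors m" by (auto simp: D_def N_def)
      also have "(\<Sum>t\<in>bit_vectors m. P u (\<mu> A) t) = 1"
        unfolding P\<mu> by (rule sum_bits_prob) (simp add: sum_bool q_def)
      finally show ?thesis .
    qed
    then have "(\<Sum>A\<in>UNIV. w * (\<Sum>t\<in>N. P u (\<mu> A) t)) = (\<Sum>A\<in>UNIV. w - w * (\<Sum>t\<in>D. P u (\<mu> A) t))"
      by (intro sum.cong refl) (metis add_diff_cancel_left' mult.right_neutral right_diff_distrib)
    then have "(\<Sum>A\<in>UNIV. w * (\<Sum>t\<in>N. P u (\<mu> A) t)) = 1 - (\<Sum>A\<in>UNIV. w * (\<Sum>t\<in>D. P u (\<mu> A) t))"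
      using w by (simp add: sum_subtractf)
    ultimately show "1 - 42 * c \<le> (\<Sum>t\<in>D. P u 0 t) + (\<Sum>A\<in>UNIV. w * (\<Sum>t\<in>N. P u (\<mu> A) t))"
      by linarith
  qed simp
  finally show ?thesis using avg C.prob_space by simp
qed

theorem theorem1:
  fixes m n :: nat and \<alpha> c \<rho> :: real
  assumes "m \<ge> 1" and "n \<ge> 1"
    and "0 < \<alpha>" and "\<alpha> < 1"
    and "0 < c" and "c \<le> (1 - \<alpha>)\<^sup>2 / 384"
    and "0 < \<rho>"
    and "\<rho>\<^sup>2 < c * sqrt (real CARD('d) * real (min m CARD('d))) / real n"
  shows "(INF T\<in>(dist_tests m :: ('d::finite) dist_test set). risk m n \<rho> T) > \<alpha>"
proof -
  define d where "d = real CARD('d)"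
  have "(1 - \<alpha>)\<^sup>2 \<le> 1 - \<alpha>" using assms(3,4) by (simp add: power2_eq_square mult_left_le_one_le)
  then have c: "384 * c \<le> 1 - \<alpha>" using assms(6) by simp
  \<comment> \<open>The minimum is used twice: bounding it by the dimension yields
    \<open>c1\<close>, bounding it by \<open>m\<close> yields \<open>c2\<close>.\<close>
  have n: "n * \<rho>\<^sup>2 \<le> c * sqrt (d * real (min m CARD('d)))"
    using assms(2,8) by (simp add: d_def field_simps)
  also have "\<dots> \<le> c * sqrt (d * d)"
    using assms(5) by (intro mult_left_mono real_sqrt_le_mono mult_left_mono) (auto simp: d_def)
  finally have c1: "n * \<rho>\<^sup>2 \<le> c * CARD('d)" by (simp add: d_def)
  have "(n * \<rho>\<^sup>2)\<^sup>2 \<le> (c * sqrt (d * real (min m CARD('d))))\<^sup>2"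
    using n by (intro power_mono) auto
  also have "\<dots> = c\<^sup>2 * (d * real (min m CARD('d)))" by (simp add: power_mult_distrib d_def)
  also have "\<dots> \<le> c\<^sup>2 * (d * m)" by (intro mult_left_mono) (auto simp: d_def)
  finally have c2: "(n * \<rho>\<^sup>2)\<^sup>2 \<le> c\<^sup>2 * (m * CARD('d))" by (simp add: d_def mult_ac)
  \<comment> \<open>Strictness survives the infimum because \<open>1 - 42 * c\<close> bounds the
    risk of all tests at once; it exceeds \<open>\<alpha>\<close> since
    \<open>42 * c < 384 * c \<le> 1 - \<alpha>\<close>.\<close>
  have "\<alpha> < 1 - 42 * c" using c assms(5) by simp
  also have "\<dots> \<le> (INF T\<in>(dist_tests m :: 'd dist_test set). risk m n \<rho> T)"
    using c c1 c2 assms by (intro cINF_greatest dist_tests_nonempty risk_ge) auto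
  finally show ?thesis .
qed

end
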